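(* For all positive integers $m$, positive real $x$ and sets $\mathcal R\subseteq[1,x]$ of integers $r$ with $\gcd(r,m)=1$, we have $$\sum_{\substack{a=1\\ \gcd(a,m)=1}}^m\left|Q(\mathcal R,x;m,a)-\vartheta_m\frac{|\mathcal R|x}{m}\right|\le |\mathcal R|^{3/4}x^{3/4}m^{1/4+o(1)},$$ where $$\vartheta_m=\frac{6}{\pi^2}\prod_{p\mid m}\left(1-\frac1{p^2}\right)^{-1},$$ the product being over primes $p\mid m$.
   Context: $Q(\mathcal R,x;m,a)$ denotes the number of solutions of the congruence $rs\equiv a\pmod m$ with $r\in\mathcal R$ and $s$ a positive squarefree integer, $s\le x$. $|\mathcal R|$ is the cardinality of $\mathcal R$. The bound with $m^{1/4+o(1)}$ is understood in the usual sense, with $o(1)$ tending to $0$ as $m\to\infty$, uniformly in the other parameters: for every $\varepsilon>0$ there is a constant $C(\varepsilon)$ depending only on $\varepsilon$ such that the left-hand side is at most $C(\varepsilon)|\mathcal R|^{3/4}x^{3/4}m^{1/4+\varepsilon}$. *)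

theory Defs
  imports
    "HOL-Analysis.Analysis"
    "HOL-Number_Theory.Cong"
    "HOL-Computational_Algebra.Squarefree"
begin

(* Solutions are counted as pairs (r, s). The set is finite whenever R is, since s <= x. *)
definition Q :: "nat set \<Rightarrow> real \<Rightarrow> nat \<Rightarrow> nat \<Rightarrow> nat" where
  "Q R x m a = card {(r, s). r \<in> R \<and> 0 < s \<and> squarefree s \<and> real s \<le> x \<and> [r * s = a] (mod m)}"

definition vartheta :: "nat \<Rightarrow> real" where
  "vartheta m = 6 / pi\<^sup>2 * (\<Prod>p\<in>prime_factors m. inverse (1 - 1 / (real p)\<^sup>2))"

end

theory Submission
  imports Defs "HOL-Library.Centered_Division"
begin

text \<open>
  Write \<open>n = card R\<close>. The sum over squarefree \<open>s\<close> is reduced to sums over all integers, and those are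
  handled on average over the residue class by Fourier analysis modulo \<open>m\<close>.

  \<^bold>\<open>All integers.\<close> For a fixed unit \<open>c\<close> and \<open>Y \<le> x\<close>, let \<open>N(a)\<close> count the pairs \<open>(r, t)\<close> with \<open>r \<in> R\<close>,
  \<open>1 \<le> t \<le> Y\<close> and \<open>c r t \<equiv> a\<close>. By Parseval the variance, the sum over \<open>a\<close> of the squares of
  \<open>N(a) - n Y / m\<close>, is \<open>1/m\<close> times the sum over \<open>0 < h < m\<close> of the squared modulus of
  the sum over \<open>r\<close> of Dirichlet kernels at \<open>h c r / m\<close>.
  Such a kernel is large only if the residue \<open>u\<close> of \<open>h c r\<close> nearest to zero is small, so after a dyadic
  decomposition one has to count triples \<open>(h, r, r')\<close> for which both \<open>h c r \<equiv> u\<close> and \<open>h c r' \<equiv> v\<close> are at most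
  \<open>K\<close> in absolute value. Eliminating \<open>h\<close> leaves \<open>r' u \<equiv> r v\<close>: once \<open>r\<close> and \<open>v\<close> are chosen, the product
  \<open>r' u\<close> lies in one residue class and in a short interval, and the divisor bound limits the number of its
  factorizations. This shows that the variance is at most \<open>n x\<close> up to factors \<open>m\<^sup>\<epsilon>\<close>
  (\<open>residue_variance_le\<close>), which is square-root cancellation. By Cauchy--Schwarz the
  discrepancy summed over \<open>a\<close> is at most about \<open>(m n x)\<^bsup>1/2\<^esup>\<close>, uniformly in \<open>c\<close> and \<open>Y\<close>.

  \<^bold>\<open>Squarefree integers.\<close> The indicator of squarefree \<open>s\<close> is the sum of \<open>\<mu>(d)\<close> over \<open>d\<^sup>2 dvd s\<close>. Writing
  \<open>s = d\<^sup>2 t\<close>, each \<open>d\<close> prime to \<open>m\<close> contributes a problem of the above kind with \<open>c = d\<^sup>2\<close> and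
  \<open>Y = x / d\<^sup>2\<close>. For \<open>d \<le> D\<close> the discrepancy bound is used, for \<open>d > D\<close> the trivial bound \<open>2 n x / d\<^sup>2\<close>;
  the total \<open>D (m n x)\<^bsup>1/2\<^esup> + n x / D\<close> is balanced by \<open>D = (n x / m)\<^bsup>1/4\<^esup>\<close> and gives
  \<open>(n x)\<^bsup>3/4\<^esup> m\<^bsup>1/4\<^esup>\<close>. The main terms add up to
  \<open>n x / m\<close> times the sum of \<open>\<mu>(d) / d\<^sup>2\<close> over \<open>d\<close> prime to \<open>m\<close>, which is
  \<open>vartheta m\<close> (\<open>vartheta_eq_infsum_moebius\<close>).
\<close>

section \<open>A divisor bound\<close>

lemma card_divisors_prime_power_mult_le:
  fixes p k n :: nat
  assumes "prime p" "n > 0"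
  shows "card {d. d dvd p ^ k * n} \<le> (k + 1) * card {d. d dvd n}"
proof -
  have fin: "finite {d. d dvd n}" using assms by simp
  have "{d. d dvd p ^ k * n} \<subseteq> (\<lambda>(i, b). p ^ i * b) ` ({..k} \<times> {d. d dvd n})"
  proof
    fix d assume "d \<in> {d. d dvd p ^ k * n}"
    then obtain a b where ab: "d = a * b" "a dvd p ^ k" "b dvd n"
      using division_decomp[of d "p ^ k" n] by auto
    then obtain i where "i \<le> k" "a = p ^ i"
      using assms by (auto simp: divides_primepow_nat)
    then show "d \<in> (\<lambda>(i, b). p ^ i * b) ` ({..k} \<times> {d. d dvd n})" using ab by auto
  qed
  then have "card {d. d dvd p ^ k * n} \<le> card ({..k} \<times> {d. d dvd n})"
    using fin by (intro surj_card_le) auto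
  then show ?thesis by (simp add: card_cartesian_product)
qed

text \<open>
  This bounds the local factors of the divisor function at small primes, \<open>2\<close> being the worst case.
\<close>
lemma linear_le_const_mult_two_powr:
  fixes \<epsilon> :: real
  assumes "\<epsilon> > 0"
  obtains A where "A \<ge> 1" "\<And>k::nat. real k + 1 \<le> A * 2 powr (\<epsilon> * real k)"
proof
  define A where "A = max 1 (1 / (\<epsilon> * ln 2))"
  show "A \<ge> 1" by (simp add: A_def)
  fix k :: nat
  have pos: "\<epsilon> * ln 2 > 0" using assms by simp
  have "1 / (\<epsilon> * ln 2) \<le> A" by (simp add: A_def)
  then have "1 \<le> A * (\<epsilon> * ln 2)" using pos by (simp add: field_simps)
  then have "real k * 1 \<le> real k * (A * (\<epsilon> * ln 2))" by (intro mult_left_mono) auto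
  then have "real k + 1 \<le> A * (1 + \<epsilon> * real k * ln 2)"
    using \<open>A \<ge> 1\<close> by (simp add: algebra_simps)
  also have "\<dots> \<le> A * exp (\<epsilon> * real k * ln 2)"
    using \<open>A \<ge> 1\<close> by (intro mult_left_mono exp_ge_add_one_self) auto
  finally show "real k + 1 \<le> A * 2 powr (\<epsilon> * real k)" by (simp add: powr_def)
qed

text \<open>
  The quotient of the divisor count by \<open>n powr \<epsilon>\<close> is multiplicative, with local factor
  \<open>(k + 1) / p powr (\<epsilon> k)\<close> at a prime power. That factor is at most 1 as soon as \<open>p powr \<epsilon> \<ge> 2\<close>, and is
  bounded by a constant \<open>A\<close> for the finitely many smaller primes.
\<close>
lemma card_divisors_le_powr:
  fixes \<epsilon> :: real
  assumes "\<epsilon> > 0"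
  obtains C where "C \<ge> 1" "\<And>n::nat. n > 0 \<Longrightarrow> real (card {d. d dvd n}) \<le> C * real n powr \<epsilon>"
proof -
  obtain A where A: "A \<ge> 1" "\<And>k::nat. real k + 1 \<le> A * 2 powr (\<epsilon> * real k)"
    using linear_le_const_mult_two_powr[OF assms] by blast
  define P where "P = nat \<lceil>2 powr (1 / \<epsilon>)\<rceil>"
  have large: "2 \<le> real p powr \<epsilon>" if "p \<ge> P" for p
  proof -
    have "2 powr (1 / \<epsilon>) \<le> real p" using that unfolding P_def by linarith
    then have "(2 powr (1 / \<epsilon>)) powr \<epsilon> \<le> real p powr \<epsilon>"
      using assms by (intro powr_mono2) auto
    then show ?thesis using assms by (simp add: powr_powr)
  qed
  have main: "real (card {d. d dvd n}) \<le> A ^ card {p \<in> prime_factors n. p < P} * real n powr \<epsilon>"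
    if "n > 0" for n :: nat
    using that
  proof (induction n rule: less_induct)
    case (less n)
    show ?case
    proof (cases "n = 1")
      case True
      then show ?thesis by simp
    next
      case False
      then obtain p where p: "prime p" "p dvd n" using prime_factor_nat by blast
      obtain n' where n': "n = p ^ multiplicity p n * n'" "\<not> p dvd n'"
        using multiplicity_decompose'[of n p] less.prems p(1) by (metis not_prime_unit neq0_conv)
      define k where "k = multiplicity p n"
      have nk: "n = p ^ k * n'" using n' k_def by simp
      have k: "k > 0" using p less.prems unfolding k_def
        by (simp add: prime_multiplicity_gt_zero_iff)
      have n'0: "n' > 0" using less.prems n' by (cases n') auto
      have p1: "p > 1" using p prime_gt_1_nat by blast
      have lt: "n' < n" using nk n'0 one_less_power[OF p1 k] by simp
      have pf: "prime_factors n = insert p (prime_factors n')"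
        unfolding nk using n'0 p k p1
        by (subst prime_factorization_mult)
           (auto simp: prime_factorization_prime_power)
      have notin: "p \<notin> prime_factors n'" using n' by auto
      define c where "c = (if p < P then A else 1)"
      have step: "real k + 1 \<le> c * real p powr (\<epsilon> * real k)"
      proof (cases "p < P")
        case True
        have "2 powr (\<epsilon> * real k) \<le> real p powr (\<epsilon> * real k)"
          using p1 assms by (intro powr_mono2) auto
        then show ?thesis using A(2)[of k] A(1) True unfolding c_def
          by (smt (verit) mult_left_mono)
      next
        case False
        have "real k + 1 \<le> 2 ^ k" using Suc_leI[OF less_exp[of k]]
          by (metis Suc_eq_plus1 of_nat_1 of_nat_add of_nat_le_iff of_nat_numeral of_nat_power)
        also have "\<dots> \<le> (real p powr \<epsilon>) ^ k" using large[of p] False by (intro power_mono) auto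
        also have "\<dots> = real p powr (\<epsilon> * real k)" using p1 by (simp add: powr_powr flip: powr_realpow)
        finally show ?thesis using False by (simp add: c_def)
      qed
      have cnt: "A ^ card {q \<in> prime_factors n. q < P}
          = c * A ^ card {q \<in> prime_factors n'. q < P}"
      proof (cases "p < P")
        case True
        then have "{q \<in> prime_factors n. q < P} = insert p {q \<in> prime_factors n'. q < P}"
          using pf by auto
        then show ?thesis using notin True by (simp add: c_def)
      next
        case False
        then have "{q \<in> prime_factors n. q < P} = {q \<in> prime_factors n'. q < P}"
          using pf by auto
        then show ?thesis using False by (simp add: c_def)
      qed
      have "real (card {d. d dvd n}) \<le> real ((k + 1) * card {d. d dvd n'})"
        using card_divisors_prime_power_mult_le[OF p(1) n'0, of k] nk of_nat_mono by metis
      also have "\<dots> = (real k + 1) * real (card {d. d dvd n'})" by (simp add: algebra_simps)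
      also have "\<dots> \<le> (c * real p powr (\<epsilon> * real k)) *
          (A ^ card {q \<in> prime_factors n'. q < P} * real n' powr \<epsilon>)"
        using step less.IH[OF lt n'0] A(1) by (intro mult_mono) (auto simp: c_def)
      also have "\<dots> = A ^ card {q \<in> prime_factors n. q < P} * (real p powr (\<epsilon> * real k) * real n' powr \<epsilon>)"
        unfolding cnt by simp
      also have "real p powr (\<epsilon> * real k) * real n' powr \<epsilon> = real n powr \<epsilon>"
      proof -
        have "real n powr \<epsilon> = (real p ^ k) powr \<epsilon> * real n' powr \<epsilon>"
          unfolding nk using p1 n'0 by (simp add: powr_mult)
        also have "real p ^ k = real p powr real k" using p1 by (simp add: powr_realpow)
        finally show ?thesis by (simp add: powr_powr mult.commute)
      qed
      finally show ?thesis .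
    qed
  qed
  show thesis
  proof
    show "A ^ P \<ge> 1" using A(1) by simp
    fix n :: nat assume n: "n > 0"
    have "card {p \<in> prime_factors n. p < P} \<le> card {..<P}" by (intro card_mono) auto
    then have "A ^ card {p \<in> prime_factors n. p < P} \<le> A ^ P"
      using A(1) by (intro power_increasing) auto
    then show "real (card {d. d dvd n}) \<le> A ^ P * real n powr \<epsilon>"
      using main[OF n] by (smt (verit) mult_right_mono powr_ge_zero)
  qed
qed

section \<open>The Moebius function and the density of squarefree numbers\<close>

definition moebius :: "nat \<Rightarrow> real" where
  "moebius n = (if squarefree n then (-1) ^ card (prime_factors n) else 0)"

lemma moebius_1 [simp]: "moebius 1 = 1" "moebius (Suc 0) = 1"
  by (simp_all add: moebius_def)

lemma abs_moebius_le_1: "\<bar>moebius n\<bar> \<le> 1"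
  by (simp add: moebius_def power_abs)

lemma moebius_prime_mult:
  assumes "prime p" "\<not> p dvd n"
  shows "moebius (p * n) = - moebius n"
proof -
  have n: "n > 0" using assms(2) by (cases n) auto
  have cop: "coprime p n" using assms by (simp add: prime_imp_coprime)
  have sf: "squarefree (p * n) \<longleftrightarrow> squarefree n"
    using squarefree_mult_coprime[OF cop] squarefree_prime[OF assms(1)] squarefree_multD(2)
    by blast
  have "prime_factors (p * n) = insert p (prime_factors n)"
    using assms n by (subst prime_factorization_mult) (auto simp: prime_factorization_prime)
  moreover have "p \<notin> prime_factors n" using assms by auto
  ultimately show ?thesis by (simp add: moebius_def sf)
qed

lemma moebius_prime_mult_dvd:
  assumes "prime p" "p dvd n"
  shows "moebius (p * n) = 0"
proof -
  have "p ^ 2 dvd p * n" using assms by (simp add: power2_eq_square)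
  then have "\<not> squarefree (p * n)" using assms not_squarefreeI not_prime_unit by blast
  then show ?thesis by (simp add: moebius_def)
qed

text \<open>
  For a prime \<open>p dvd n\<close>, the divisors \<open>d\<close> and \<open>p d\<close> with \<open>p\<close> not dividing \<open>d\<close> cancel in pairs; the
  remaining divisors are multiples of \<open>p\<^sup>2\<close>, on which the Moebius function vanishes.
\<close>
lemma sum_moebius_divisors:
  assumes "n > 0"
  shows "(\<Sum>d | d dvd n. moebius d) = (if n = 1 then 1 else 0)"
proof (cases "n = 1")
  case True
  then show ?thesis by simp
next
  case False
  then obtain p where p: "prime p" "p dvd n" using prime_factor_nat by blast
  define D where "D = {d. d dvd n \<and> \<not> p dvd d}"
  have fin: "finite {d. d dvd n}" using assms by simp
  have sub: "(*) p ` D \<subseteq> {d. d dvd n \<and> p dvd d}"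
    using p by (auto simp: D_def intro!: divides_mult prime_imp_coprime)
  have zero: "moebius d = 0" if d: "d \<in> {d. d dvd n \<and> p dvd d} - (*) p ` D" for d
  proof -
    obtain e where e: "d = p * e" using d by (auto simp: dvd_def)
    then have "e dvd n" using d dvd_mult_right by blast
    then have "p dvd e" using d e by (auto simp: D_def)
    then show ?thesis using moebius_prime_mult_dvd p e by blast
  qed
  have "(\<Sum>d | d dvd n. moebius d) = (\<Sum>d\<in>D. moebius d) + (\<Sum>d | d dvd n \<and> p dvd d. moebius d)"
    using fin unfolding D_def
    by (subst sum.union_disjoint[symmetric]) (auto intro!: sum.cong)
  also have "(\<Sum>d | d dvd n \<and> p dvd d. moebius d) = (\<Sum>d\<in>(*) p ` D. moebius d)"
    using fin sub zero by (intro sum.mono_neutral_right) auto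
  also have "\<dots> = (\<Sum>d\<in>D. moebius (p * d))"
    using p by (subst sum.reindex) (auto simp: inj_on_def)
  also have "\<dots> = (\<Sum>d\<in>D. - moebius d)"
    using p by (intro sum.cong) (auto simp: D_def moebius_prime_mult)
  finally show ?thesis using False by (simp add: sum_negf)
qed

lemma sum_moebius_square_divisors:
  assumes "n > 0"
  shows "(\<Sum>d | d\<^sup>2 dvd n. moebius d) = (if squarefree n then 1 else 0)"
proof -
  have "(\<Sum>d | d\<^sup>2 dvd n. moebius d) = (\<Sum>d | d dvd square_part n. moebius d)"
    by (simp add: dvd_square_part_iff)
  also have "\<dots> = (if square_part n = 1 then 1 else 0)"
    using assms by (intro sum_moebius_divisors) (metis gr0I less_irrefl square_part_0_iff)
  also have "square_part n = 1 \<longleftrightarrow> squarefree n"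
    by (metis dvd_refl dvd_square_part_iff nat_dvd_1_iff_1 one_dvd squarefree_def)
  finally show ?thesis .
qed

lemma inverse_squares_has_sum: "((\<lambda>n::nat. 1 / (real n)\<^sup>2) has_sum pi\<^sup>2 / 6) {0<..}"
proof -
  have "((\<lambda>n::nat. 1 / (real (Suc n))\<^sup>2) has_sum pi\<^sup>2 / 6) UNIV"
    using inverse_squares_sums by (intro sums_nonneg_imp_has_sum) auto
  moreover have "bij_betw Suc UNIV {0<..}"
    by (rule bij_betwI[where g = "\<lambda>n. n - 1"]) auto
  ultimately show ?thesis
    using has_sum_reindex_bij_betw[of Suc UNIV "{0<..}" "\<lambda>n. 1 / (real n)\<^sup>2"] by blast
qed

lemma moebius_abs_summable:
  assumes "A \<subseteq> {0<..}"
  shows "(\<lambda>d. norm (moebius d / (real d)\<^sup>2)) summable_on A"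
proof (rule Infinite_Sum.abs_summable_on_comparison_test')
  show "(\<lambda>n::nat. 1 / (real n)\<^sup>2) summable_on A"
    using inverse_squares_has_sum assms summable_on_subset_banach has_sum_imp_summable by blast
  show "norm (moebius d / (real d)\<^sup>2) \<le> 1 / (real d)\<^sup>2" for d
    using abs_moebius_le_1[of d] by (simp add: divide_right_mono)
qed

lemma moebius_summable:
  assumes "A \<subseteq> {0<..}"
  shows "(\<lambda>d. moebius d / (real d)\<^sup>2) summable_on A"
  by (rule Infinite_Sum.abs_summable_summable[OF moebius_abs_summable[OF assms]])

text \<open>
  Multiplying by the series of \<open>1 / n\<^sup>2\<close>, whose value is \<open>pi\<^sup>2 / 6\<close>, and grouping the absolutely convergent
  double series by \<open>k = d n\<close> leaves the single term \<open>k = 1\<close>.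
\<close>
lemma infsum_moebius_inverse_squares:
  "(\<Sum>\<^sub>\<infinity>d\<in>{0<..}. moebius d / (real d)\<^sup>2) = 6 / pi\<^sup>2"
proof -
  let ?N = "{0::nat<..}"
  define f where "f = (\<lambda>d n. moebius d / (real d)\<^sup>2 * (1 / (real n)\<^sup>2))"
  have zeta: "(\<lambda>n::nat. 1 / (real n)\<^sup>2) summable_on ?N" "(\<Sum>\<^sub>\<infinity>n\<in>?N. 1 / (real n)\<^sup>2) = pi\<^sup>2 / 6"
    using inverse_squares_has_sum has_sum_imp_summable infsumI by blast+
  have abs: "(\<lambda>z. norm (case z of (d, n) \<Rightarrow> f d n)) summable_on ?N \<times> ?N"
  proof (subst Infinite_Sum.abs_summable_on_Sigma_iff, intro conjI ballI)
    fix d :: nat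
    have "(\<lambda>n. \<bar>moebius d / (real d)\<^sup>2\<bar> * (1 / (real n)\<^sup>2)) summable_on ?N"
      by (intro summable_on_cmult_right zeta)
    then show "(\<lambda>n. norm (case (d, n) of (d, n) \<Rightarrow> f d n)) summable_on ?N"
      by (simp add: f_def abs_mult)
  next
    have "(\<lambda>d. norm (moebius d / (real d)\<^sup>2) * (pi\<^sup>2 / 6)) summable_on ?N"
      by (intro summable_on_cmult_left moebius_abs_summable) auto
    moreover have "(\<Sum>\<^sub>\<infinity>n\<in>?N. norm (f d n)) = norm (moebius d / (real d)\<^sup>2) * (pi\<^sup>2 / 6)" for d
    proof -
      have "(\<Sum>\<^sub>\<infinity>n\<in>?N. norm (f d n)) = (\<Sum>\<^sub>\<infinity>n\<in>?N. norm (moebius d / (real d)\<^sup>2) * (1 / (real n)\<^sup>2))"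
        by (simp add: f_def abs_mult)
      then show ?thesis by (simp only: infsum_cmult_right' zeta)
    qed
    ultimately show "(\<lambda>d. norm (\<Sum>\<^sub>\<infinity>n\<in>?N. norm (case (d, n) of (d, n) \<Rightarrow> f d n))) summable_on ?N"
      by (simp add: abs_mult)
  qed
  then have summ: "(\<lambda>(d, n). f d n) summable_on ?N \<times> ?N"
    by (rule Infinite_Sum.abs_summable_summable)
  let ?S = "SIGMA k:?N. {d. d dvd k}"
  let ?g = "\<lambda>(k, d). moebius d / (real k)\<^sup>2"
  let ?h = "\<lambda>(d, n). (d * n, d)"
  have bij: "bij_betw ?h (?N \<times> ?N) ?S"
    by (rule bij_betwI[where g = "\<lambda>(k, d). (d, k div d)"])
       (auto simp: dvd_div_eq_0_iff intro!: Nat.gr0I)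
  have fg: "(\<lambda>(d, n). f d n) = (\<lambda>z. ?g (?h z))"
    by (auto simp: f_def power_mult_distrib fun_eq_iff)
  have summ': "?g summable_on ?S"
    using summ summable_on_reindex_bij_betw[OF bij, of ?g] fg by simp
  have "(\<Sum>\<^sub>\<infinity>d\<in>?N. moebius d / (real d)\<^sup>2) * (pi\<^sup>2 / 6)
      = (\<Sum>\<^sub>\<infinity>d\<in>?N. \<Sum>\<^sub>\<infinity>n\<in>?N. f d n)"
    unfolding f_def by (simp only: infsum_cmult_right' infsum_cmult_left' zeta)
  also have "\<dots> = (\<Sum>\<^sub>\<infinity>(d, n)\<in>?N \<times> ?N. f d n)"
    by (rule infsum_Sigma'_banach[OF summ])
  also have "\<dots> = (\<Sum>\<^sub>\<infinity>z\<in>?S. ?g z)"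
    using infsum_reindex_bij_betw[OF bij, of ?g] fg by simp
  also have "\<dots> = (\<Sum>\<^sub>\<infinity>k\<in>?N. \<Sum>\<^sub>\<infinity>d\<in>{d. d dvd k}. moebius d / (real k)\<^sup>2)"
    using infsum_Sigma'_banach[OF summ'] by simp
  also have "\<dots> = (\<Sum>\<^sub>\<infinity>k\<in>?N. if k = 1 then 1 else 0)"
  proof (rule infsum_cong)
    fix k :: nat assume "k \<in> ?N"
    then have "(\<Sum>\<^sub>\<infinity>d\<in>{d. d dvd k}. moebius d / (real k)\<^sup>2) = (\<Sum>d | d dvd k. moebius d) / (real k)\<^sup>2"
      by (simp add: sum_divide_distrib)
    then show "(\<Sum>\<^sub>\<infinity>d\<in>{d. d dvd k}. moebius d / (real k)\<^sup>2) = (if k = 1 then 1 else 0)"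
      using \<open>k \<in> ?N\<close> sum_moebius_divisors[of k] by auto
  qed
  also have "\<dots> = (\<Sum>\<^sub>\<infinity>k\<in>{1::nat}. 1)"
    by (intro infsum_cong_neutral) auto
  also have "\<dots> = (1::real)" by simp
  finally show ?thesis by (simp add: field_simps)
qed

text \<open>
  One Euler factor: the terms with \<open>p dvd d\<close> are those at \<open>d = p e\<close> with \<open>p\<close> not dividing \<open>e\<close> (the others
  vanish), and each is \<open>- 1 / p\<^sup>2\<close> times the term at \<open>e\<close>.
\<close>
lemma infsum_moebius_remove_prime:
  fixes P :: "nat set"
  assumes p: "prime p" "p \<notin> P" and P: "\<And>q. q \<in> P \<Longrightarrow> prime q"
  defines "E \<equiv> \<lambda>P. {d::nat. d > 0 \<and> (\<forall>q\<in>P. \<not> q dvd d)}"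
  shows "(\<Sum>\<^sub>\<infinity>d\<in>E P. moebius d / (real d)\<^sup>2)
    = (1 - 1 / (real p)\<^sup>2) * (\<Sum>\<^sub>\<infinity>d\<in>E (insert p P). moebius d / (real d)\<^sup>2)"
proof -
  let ?f = "\<lambda>d. moebius d / (real d)\<^sup>2"
  define F where "F = {d \<in> E P. p dvd d}"
  have p0: "p > 0" using p prime_gt_0_nat by blast
  have un: "E P = E (insert p P) \<union> F" "E (insert p P) \<inter> F = {}"
    by (auto simp: E_def F_def)
  have ndvd: "\<not> q dvd p" if "q \<in> P" for q
    using P[OF that] p that primes_dvd_imp_eq by blast
  have img: "(*) p ` E (insert p P) \<subseteq> F"
    using p0 ndvd P by (auto simp: E_def F_def prime_dvd_mult_iff)
  have zero: "?f d = 0" if d: "d \<in> F - (*) p ` E (insert p P)" for d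
  proof -
    obtain e where e: "d = p * e" using d by (auto simp: F_def dvd_def)
    have "p dvd e"
    proof (rule ccontr)
      assume "\<not> p dvd e"
      then have "e \<in> E (insert p P)" using d e by (auto simp: E_def F_def)
      then show False using d e by blast
    qed
    then show ?thesis using e p moebius_prime_mult_dvd by simp
  qed
  have "(\<Sum>\<^sub>\<infinity>d\<in>E P. ?f d) = (\<Sum>\<^sub>\<infinity>d\<in>E (insert p P). ?f d) + (\<Sum>\<^sub>\<infinity>d\<in>F. ?f d)"
    unfolding un(1)
    by (intro infsum_Un_disjoint moebius_summable un(2)) (auto simp: E_def F_def)
  also have "(\<Sum>\<^sub>\<infinity>d\<in>F. ?f d) = (\<Sum>\<^sub>\<infinity>d\<in>(*) p ` E (insert p P). ?f d)"
    using img zero by (intro infsum_cong_neutral) blast+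
  also have "\<dots> = (\<Sum>\<^sub>\<infinity>d\<in>E (insert p P). ?f (p * d))"
    using p0 by (subst infsum_reindex) (auto simp: inj_on_def o_def)
  also have "\<dots> = (\<Sum>\<^sub>\<infinity>d\<in>E (insert p P). (- 1 / (real p)\<^sup>2) * ?f d)"
    using p by (intro infsum_cong) (auto simp: E_def moebius_prime_mult power_mult_distrib)
  also have "\<dots> = (- 1 / (real p)\<^sup>2) * (\<Sum>\<^sub>\<infinity>d\<in>E (insert p P). ?f d)"
    by (rule infsum_cmult_right')
  finally show ?thesis by (simp add: algebra_simps)
qed

lemma vartheta_eq_infsum_moebius:
  assumes "m > 0"
  shows "vartheta m = (\<Sum>\<^sub>\<infinity>d\<in>{d. d > 0 \<and> coprime d m}. moebius d / (real d)\<^sup>2)"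
proof -
  have "(\<Sum>\<^sub>\<infinity>d\<in>{d::nat. d > 0 \<and> (\<forall>q\<in>P. \<not> q dvd d)}. moebius d / (real d)\<^sup>2)
      = 6 / pi\<^sup>2 * (\<Prod>p\<in>P. inverse (1 - 1 / (real p)\<^sup>2))"
    if "finite P" "\<And>q. q \<in> P \<Longrightarrow> prime q" for P
    using that
  proof (induction P rule: finite_induct)
    case empty
    have "{d::nat. d > 0 \<and> (\<forall>q\<in>{}. \<not> q dvd d)} = {0<..}" by auto
    then show ?case using infsum_moebius_inverse_squares by simp
  next
    case (insert p P)
    have "real p > 1" using insert.prems prime_gt_1_nat[of p] by simp
    then have "(real p)\<^sup>2 > 1" by simp
    then have nz: "1 - 1 / (real p)\<^sup>2 \<noteq> 0" by simp
    let ?A = "\<lambda>P. (\<Sum>\<^sub>\<infinity>d\<in>{d::nat. d > 0 \<and> (\<forall>q\<in>P. \<not> q dvd d)}. moebius d / (real d)\<^sup>2)"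
    have "?A P = (1 - 1 / (real p)\<^sup>2) * ?A (insert p P)"
      using insert.hyps insert.prems by (intro infsum_moebius_remove_prime) auto
    then have "?A (insert p P) = ?A P * inverse (1 - 1 / (real p)\<^sup>2)"
      using nz by (simp add: divide_inverse[symmetric] nonzero_eq_divide_eq del: inverse_eq_divide)
    then show ?case using insert by (simp del: inverse_eq_divide)
  qed
  from this[of "prime_factors m", OF _ in_prime_factors_imp_prime] have *: "vartheta m
      = (\<Sum>\<^sub>\<infinity>d\<in>{d::nat. d > 0 \<and> (\<forall>q\<in>prime_factors m. \<not> q dvd d)}. moebius d / (real d)\<^sup>2)"
    by (simp add: vartheta_def)
  have "coprime d m \<longleftrightarrow> (\<forall>q\<in>prime_factors m. \<not> q dvd d)" for d
  proof
    assume cop: "coprime d m"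
    show "\<forall>q\<in>prime_factors m. \<not> q dvd d"
    proof (intro ballI notI)
      fix q assume "q \<in> prime_factors m" "q dvd d"
      then have "prime q" "is_unit q" using cop coprime_common_divisor by blast+
      then show False by simp
    qed
  next
    assume "\<forall>q\<in>prime_factors m. \<not> q dvd d"
    show "coprime d m"
    proof (rule ccontr)
      assume "\<not> coprime d m"
      then have "gcd d m \<noteq> 1" by (simp add: coprime_iff_gcd_eq_1)
      then obtain q where "prime q" "q dvd gcd d m" using prime_factor_nat by blast
      with \<open>\<forall>q\<in>prime_factors m. \<not> q dvd d\<close> assms show False
        by (auto simp: prime_factors_dvd)
    qed
  qed
  then show ?thesis unfolding * by simp
qed

text \<open>
  Telescoping, since \<open>1 / d\<^sup>2 \<le> 2 / d - 2 / (d + 1)\<close>. In this form the bound also covers \<open>N = 0\<close>, so that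
  the cut-off \<open>D\<close> may be zero when it is used below.
\<close>
lemma sum_inverse_squares_tail_le:
  "(\<Sum>d\<in>{N<..M}. 1 / (real d)\<^sup>2) \<le> 2 / (real N + 1)"
proof (cases "N \<le> M")
  case True
  then have "(\<Sum>d\<in>{N<..M}. 1 / (real d)\<^sup>2) \<le> 2 / (real N + 1) - 2 / (real M + 1)"
  proof (induction M rule: dec_induct)
    case base
    then show ?case by simp
  next
    case (step k)
    have "1 / (real (Suc k))\<^sup>2 \<le> 2 / (real k + 1) - 2 / (real (Suc k) + 1)"
      by (simp add: divide_simps power2_eq_square) (simp add: algebra_simps)
    moreover have "{N<..Suc k} = insert (Suc k) {N<..k}" using step by auto
    ultimately show ?case using step.IH by simp
  qed
  then show ?thesis by (smt (verit) divide_nonneg_nonneg of_nat_0_le_iff)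
qed auto

lemma vartheta_partial_sum_error:
  assumes "m > 0"
  shows "\<bar>vartheta m - (\<Sum>d | d \<in> {1..M} \<and> coprime d m. moebius d / (real d)\<^sup>2)\<bar> \<le> 2 / (real M + 1)"
proof -
  let ?f = "\<lambda>d. moebius d / (real d)\<^sup>2"
  let ?T = "{d. d > M \<and> coprime d m}"
  let ?H = "{d. d \<in> {1..M} \<and> coprime d m}"
  have "{d. d > 0 \<and> coprime d m} = ?H \<union> ?T" by auto
  then have "vartheta m = (\<Sum>\<^sub>\<infinity>d\<in>?H \<union> ?T. ?f d)"
    using vartheta_eq_infsum_moebius[OF assms] by simp
  also have "\<dots> = (\<Sum>\<^sub>\<infinity>d\<in>?H. ?f d) + (\<Sum>\<^sub>\<infinity>d\<in>?T. ?f d)"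
    by (intro infsum_Un_disjoint moebius_summable) auto
  finally have eq: "vartheta m - (\<Sum>d\<in>?H. ?f d) = (\<Sum>\<^sub>\<infinity>d\<in>?T. ?f d)" by simp
  have summ: "(\<lambda>d. norm (?f d)) summable_on ?T" by (intro moebius_abs_summable) auto
  have "norm (\<Sum>\<^sub>\<infinity>d\<in>?T. ?f d) \<le> (\<Sum>\<^sub>\<infinity>d\<in>?T. norm (?f d))"
    using summ by (rule norm_infsum_bound)
  also have "\<dots> \<le> 2 / (real M + 1)"
  proof (rule infsum_le_finite_sums[OF summ])
    fix F assume F: "finite F" "F \<subseteq> ?T"
    have "(\<Sum>d\<in>F. norm (?f d)) \<le> (\<Sum>d\<in>F. 1 / (real d)\<^sup>2)"
      by (intro sum_mono) (auto intro!: divide_right_mono abs_moebius_le_1)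
    also have "\<dots> \<le> (\<Sum>d\<in>{M<..Max (insert 0 F)}. 1 / (real d)\<^sup>2)"
      using F by (intro sum_mono2) auto
    also have "\<dots> \<le> 2 / (real M + 1)" by (rule sum_inverse_squares_tail_le)
    finally show "(\<Sum>d\<in>F. norm (?f d)) \<le> 2 / (real M + 1)" .
  qed
  finally show ?thesis unfolding eq by simp
qed

section \<open>Parseval's identity and exponential sums modulo m\<close>

lemma cong_centered_modulo: "[k cmod l = k] (mod l)"
  by (metis cmod_mult_cdiv_eq cong_iff_lin mult.commute cong_sym)

lemma abs_centered_modulo_le:
  assumes "l > 0"
  shows "2 * \<bar>k cmod l\<bar> \<le> l"
proof -
  have "0 \<le> (k + l div 2) mod l" "(k + l div 2) mod l < l" using assms by auto
  moreover have "k cmod l = (k + l div 2) mod l - l div 2"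
    using assms by (simp add: centered_modulo_def)
  ultimately show ?thesis by linarith
qed

text \<open>
  Because of this, only kernels away from the frequency zero occur, and only products without a zero factor
  have to be counted; zero would have infinitely many factorizations.
\<close>
lemma centered_modulo_unit_multiple_nonzero:
  assumes "0 < h" "h < m" "coprime k m"
  shows "(int h * int k) cmod int m \<noteq> 0"
proof
  assume "(int h * int k) cmod int m = 0"
  then have "int m dvd int h * int k"
    using cong_centered_modulo[of "int h * int k" "int m"] by (simp add: cong_0_iff cong_sym_eq[of 0])
  moreover have "coprime (int k) (int m)" using assms(3) by simp
  ultimately have "int m dvd int h" by (simp add: coprime_dvd_mult_left_iff coprime_commute)
  then show False using assms by (auto dest: zdvd_imp_le)
qed

definition addchar :: "nat \<Rightarrow> int \<Rightarrow> complex" where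
  "addchar m k = cis (2 * pi * (real_of_int k / real m))"

lemma addchar_0 [simp]: "addchar m 0 = 1"
  by (simp add: addchar_def)

lemma addchar_add: "addchar m (j + k) = addchar m j * addchar m k"
  by (simp add: addchar_def cis_mult add_divide_distrib distrib_left)

lemma cnj_addchar: "cnj (addchar m k) = addchar m (- k)"
  by (simp add: addchar_def cis_cnj)

lemma norm_addchar [simp]: "norm (addchar m k) = 1"
  by (simp add: addchar_def)

lemma addchar_mult: "addchar m (int n * k) = addchar m k ^ n"
  by (induction n) (simp_all add: distrib_right addchar_add)

lemma addchar_eq_1_iff:
  assumes "m > 0"
  shows "addchar m k = 1 \<longleftrightarrow> int m dvd k"
proof
  assume "addchar m k = 1"
  then have "cos (2 * pi * (real_of_int k / real m)) = 1"
    by (simp add: addchar_def complex_eq_iff)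
  then obtain n :: int where "2 * pi * (real_of_int k / real m) = of_int n * (2 * pi)"
    by (auto simp: cos_one_2pi_int)
  then have "(2 * pi) * (real_of_int k / real m) = (2 * pi) * of_int n" by (simp only: mult.commute)
  then have "real_of_int k / real m = of_int n" by (simp only: mult_cancel_left) simp
  then have "real_of_int k = real_of_int (n * int m)" using assms by (simp add: field_simps)
  then have "k = n * int m" by (simp only: of_int_eq_iff)
  then show "int m dvd k" by simp
next
  assume "int m dvd k"
  then obtain n where "k = int m * n" by auto
  then have "2 * pi * (real_of_int k / real m) = 2 * pi * real_of_int n" using assms by simp
  then show "addchar m k = 1" unfolding addchar_def by (simp add: complex_eq_iff)
qed

lemma addchar_cong:
  assumes "m > 0" "[j = k] (mod int m)"
  shows "addchar m j = addchar m k"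
proof -
  have "int m dvd j - k" using assms(2) by (simp add: cong_iff_dvd_diff)
  then have "addchar m (k + (j - k)) = addchar m k * 1"
    using assms(1) addchar_eq_1_iff by (subst addchar_add) simp
  then show ?thesis by simp
qed

lemma addchar_orthogonality:
  assumes "m > 0"
  shows "(\<Sum>h<m. addchar m (int h * k)) = (if int m dvd k then of_nat m else 0)"
proof (cases "int m dvd k")
  case True
  then have "addchar m k = 1" using assms addchar_eq_1_iff by blast
  then show ?thesis using True by (simp add: addchar_mult)
next
  case False
  then have "addchar m k \<noteq> 1" using assms addchar_eq_1_iff by blast
  moreover have "addchar m k ^ m = 1"
    using addchar_eq_1_iff[OF assms, of "int m * k"] by (simp flip: addchar_mult)
  ultimately show ?thesis using False by (simp add: addchar_mult sum_gp_strict)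
qed

lemma complete_residues_ex1:
  fixes m k :: nat
  assumes "m > 0"
  shows "\<exists>a\<in>{1..m}. \<forall>b\<in>{1..m}. [k = b] (mod m) \<longleftrightarrow> b = a"
proof -
  define a where "a = (if k mod m = 0 then m else k mod m)"
  have a: "a \<in> {1..m}" using assms mod_less_divisor[of m k] by (auto simp: a_def simp del: mod_less_divisor)
  have ka: "[k = a] (mod m)" by (simp add: a_def cong_def)
  have "b = a" if "b \<in> {1..m}" "[k = b] (mod m)" for b
  proof -
    have "[a = b] (mod m)" using ka that cong_trans cong_sym by blast
    then have "[int a = int b] (mod int m)" by (simp add: cong_int_iff)
    then have "int m dvd int a - int b" by (simp add: cong_iff_dvd_diff)
    moreover have "\<bar>int a - int b\<bar> < int m" using a that by auto
    ultimately show ?thesis using zdvd_not_zless[of "\<bar>int a - int b\<bar>" "int m"]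
      by (cases "int a = int b") auto
  qed
  then show ?thesis using a ka by blast
qed

lemma sum_over_complete_residues:
  fixes f :: "nat \<Rightarrow> 'b::comm_monoid_add"
  assumes "m > 0" "\<And>b. [k = b] (mod m) \<Longrightarrow> f b = f k"
  shows "(\<Sum>a\<in>{1..m}. if [k = a] (mod m) then f a else 0) = f k"
proof -
  obtain a where a: "a \<in> {1..m}" "\<And>b. b \<in> {1..m} \<Longrightarrow> [k = b] (mod m) \<longleftrightarrow> b = a"
    using complete_residues_ex1[OF assms(1)] by blast
  have "(\<Sum>b\<in>{1..m}. if [k = b] (mod m) then f b else 0) = (\<Sum>b\<in>{1..m}. if b = a then f b else 0)"
    using a by (intro sum.cong) auto
  also have "\<dots> = f a" using a by simp
  also have "\<dots> = f k" using a assms by blast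
  finally show ?thesis .
qed

lemma sum_residue_counts:
  fixes P :: "'a set" and g :: "'a \<Rightarrow> nat"
  assumes "m > 0" "finite P"
  shows "(\<Sum>a\<in>{1..m}. card {p \<in> P. [g p = a] (mod m)}) = card P"
proof -
  have "card {p \<in> P. [g p = a] (mod m)} = (\<Sum>p\<in>P. if [g p = a] (mod m) then 1 else 0)" for a
    using assms by (simp add: sum.If_cases Int_def)
  then have "(\<Sum>a\<in>{1..m}. card {p \<in> P. [g p = a] (mod m)})
      = (\<Sum>p\<in>P. \<Sum>a\<in>{1..m}. if [g p = a] (mod m) then 1 else 0)"
    by (simp add: sum.swap[of _ P])
  also have "\<dots> = card P" using assms(1) by (subst sum_over_complete_residues) auto
  finally show ?thesis .
qed

lemma sum_residue_counts_square:
  fixes P :: "'a set" and g :: "'a \<Rightarrow> nat"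
  assumes "m > 0" "finite P"
  shows "(\<Sum>a\<in>{1..m}. (real (card {p \<in> P. [g p = a] (mod m)}))\<^sup>2)
    = (\<Sum>p\<in>P. \<Sum>q\<in>P. if [g p = g q] (mod m) then 1 else 0)"
proof -
  have N: "real (card {p \<in> P. [g p = a] (mod m)}) = (\<Sum>p\<in>P. if [g p = a] (mod m) then 1 else 0)" for a
    using assms by (simp add: sum.If_cases Int_def)
  have "(\<Sum>a\<in>{1..m}. (real (card {p \<in> P. [g p = a] (mod m)}))\<^sup>2)
      = (\<Sum>a\<in>{1..m}. \<Sum>p\<in>P. \<Sum>q\<in>P. if [g p = a] (mod m) then if [g q = a] (mod m) then 1 else 0 else 0)"
    unfolding N power2_eq_square sum_product by (intro sum.cong refl) auto
  also have "\<dots> = (\<Sum>p\<in>P. \<Sum>a\<in>{1..m}. \<Sum>q\<in>P. if [g p = a] (mod m) then if [g q = a] (mod m) then 1 else 0 else 0)"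
    by (rule sum.swap)
  also have "\<dots> = (\<Sum>p\<in>P. \<Sum>q\<in>P. \<Sum>a\<in>{1..m}. if [g p = a] (mod m) then if [g q = a] (mod m) then 1 else 0 else 0)"
    by (intro sum.cong refl sum.swap)
  also have "\<dots> = (\<Sum>p\<in>P. \<Sum>q\<in>P. if [g q = g p] (mod m) then 1 else 0)"
    using assms(1)
    by (intro sum.cong refl sum_over_complete_residues) (auto simp: cong_def)
  finally show ?thesis by (simp add: cong_sym_eq)
qed

text \<open>
  Parseval on the integers modulo \<open>m\<close>: the frequency \<open>h = 0\<close> is the mean value, so that
  the other frequencies measure the variance. Counting over all classes, not only the reduced
  ones, is what makes the mean exactly \<open>card P / m\<close>.
\<close>
lemma residue_counts_parseval:
  fixes P :: "'a set" and g :: "'a \<Rightarrow> nat"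
  assumes "m > 0" "finite P"
  shows "real m * (\<Sum>a\<in>{1..m}. (real (card {p \<in> P. [g p = a] (mod m)}) - real (card P) / real m)\<^sup>2)
    = (\<Sum>h\<in>{1..<m}. (norm (\<Sum>p\<in>P. addchar m (int h * int (g p))))\<^sup>2)"
proof -
  let ?N = "\<lambda>a. real (card {p \<in> P. [g p = a] (mod m)})"
  let ?F = "\<lambda>h. \<Sum>p\<in>P. addchar m (int h * int (g p))"
  let ?E = "\<Sum>p\<in>P. \<Sum>q\<in>P. if [g p = g q] (mod m) then 1 else 0 :: real"
  have "complex_of_real (\<Sum>h<m. (norm (?F h))\<^sup>2) = (\<Sum>h<m. ?F h * cnj (?F h))"
    by (simp only: of_real_sum complex_norm_square)
  also have "\<dots> = (\<Sum>h<m. \<Sum>p\<in>P. \<Sum>q\<in>P. addchar m (int h * (int (g p) - int (g q))))"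
    by (simp add: sum_product cnj_addchar right_diff_distrib flip: addchar_add)
  also have "\<dots> = (\<Sum>p\<in>P. \<Sum>h<m. \<Sum>q\<in>P. addchar m (int h * (int (g p) - int (g q))))"
    by (rule sum.swap)
  also have "\<dots> = (\<Sum>p\<in>P. \<Sum>q\<in>P. \<Sum>h<m. addchar m (int h * (int (g p) - int (g q))))"
    by (intro sum.cong refl sum.swap)
  also have "\<dots> = (\<Sum>p\<in>P. \<Sum>q\<in>P. if [g p = g q] (mod m) then of_nat m else 0)"
    using assms(1)
    by (intro sum.cong refl)
       (simp add: addchar_orthogonality cong_iff_dvd_diff flip: cong_int_iff)
  also have "\<dots> = complex_of_real (real m * ?E)"
    by (simp add: sum_distrib_left if_distrib cong: if_cong)
  finally have "(\<Sum>h<m. (norm (?F h))\<^sup>2) = real m * ?E" by (simp only: of_real_eq_iff)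
  moreover have "{..<m} = insert 0 {1..<m}" using assms by auto
  ultimately have F: "(\<Sum>h\<in>{1..<m}. (norm (?F h))\<^sup>2) = real m * ?E - (real (card P))\<^sup>2"
    by simp
  have "(\<Sum>a\<in>{1..m}. (?N a - real (card P) / real m)\<^sup>2)
      = (\<Sum>a\<in>{1..m}. (?N a)\<^sup>2 - 2 * (real (card P) / real m) * ?N a + (real (card P) / real m)\<^sup>2)"
    by (intro sum.cong refl) (simp add: power2_diff algebra_simps)
  also have "\<dots> = ?E - 2 * (real (card P) / real m) * real (card P) + real m * (real (card P) / real m)\<^sup>2"
    unfolding sum.distrib sum_subtractf sum_distrib_left[symmetric]
      sum_residue_counts_square[OF assms] of_nat_sum[symmetric] sum_residue_counts[OF assms]
    by simp
  also have "real m * \<dots> = real m * ?E - (real (card P))\<^sup>2"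
    using assms(1) by (simp add: field_simps power2_eq_square)
  finally show ?thesis using F by simp
qed

text \<open>Jordan's inequality: a concave function lies above its chord, here on \<open>[0, pi/2]\<close>.\<close>
lemma sin_ge_chord:
  assumes "0 \<le> t" "t \<le> (1::real)"
  shows "t \<le> sin (t * (pi / 2))"
proof -
  have "concave_on {0..pi} sin"
    by (rule f''_le0_imp_concave[where f' = cos and f'' = "\<lambda>x. - sin x"])
       (auto intro!: derivative_eq_intros sin_ge_zero)
  from concave_onD[OF this, of t 0 "pi / 2"] assms show ?thesis by simp
qed

lemma norm_addchar_minus_1_ge:
  assumes "m > 0"
  shows "4 * real_of_int \<bar>k cmod int m\<bar> / real m \<le> norm (1 - addchar m k)"
proof -
  let ?s = "k cmod int m"
  define t where "t = 2 * real_of_int \<bar>?s\<bar> / real m"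
  have "real_of_int (2 * \<bar>?s\<bar>) \<le> real_of_int (int m)"
    using abs_centered_modulo_le[of "int m" k] assms by (subst of_int_le_iff) simp
  then have t: "0 \<le> t" "t \<le> 1" using assms by (auto simp: t_def divide_simps)
  have "norm (1 - addchar m k) = norm (addchar m ?s - 1)"
    using addchar_cong[OF assms cong_centered_modulo[of k "int m"]] by (simp add: norm_minus_commute)
  also have "\<dots> = norm (exp (\<i> * of_real (2 * pi * (real_of_int ?s / real m))) - 1)"
    unfolding addchar_def cis_conv_exp by simp
  also have "\<dots> = 2 * \<bar>sin (pi * (real_of_int ?s / real m))\<bar>"
    unfolding dist_exp_i_1 by simp
  also have "\<bar>sin (pi * (real_of_int ?s / real m))\<bar> = \<bar>sin \<bar>pi * (real_of_int ?s / real m)\<bar>\<bar>"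
    by (simp add: abs_if)
  also have "\<bar>pi * (real_of_int ?s / real m)\<bar> = t * (pi / 2)"
    by (simp add: t_def abs_mult)
  finally have "norm (1 - addchar m k) = 2 * \<bar>sin (t * (pi / 2))\<bar>" .
  then show ?thesis using sin_ge_chord[OF t] by (simp add: t_def)
qed

text \<open>
  The usual bound for the Dirichlet kernel: the sum is geometric, and its denominator \<open>1 - addchar m k\<close> is
  bounded below by the distance of \<open>k\<close> to the nearest multiple of \<open>m\<close>.
\<close>
lemma norm_sum_addchar_le:
  assumes "m > 0" "k cmod int m \<noteq> 0"
  shows "norm (\<Sum>t\<in>{1..Y}. addchar m (int t * k)) \<le> real m / (2 * real_of_int \<bar>k cmod int m\<bar>)"
proof -
  let ?z = "addchar m k"
  have pos: "4 * real_of_int \<bar>k cmod int m\<bar> / real m > 0" using assms by simp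
  then have z: "?z \<noteq> 1" using norm_addchar_minus_1_ge[OF assms(1), of k] by auto
  have "(\<Sum>t\<in>{1..Y}. addchar m (int t * k)) = (\<Sum>t<Y. ?z ^ Suc t)"
    unfolding addchar_mult
    by (rule sum.reindex_bij_witness[where i = Suc and j = "\<lambda>t. t - 1"]) auto
  also have "\<dots> = ?z * (1 - ?z ^ Y) / (1 - ?z)"
    using z by (simp add: sum_gp_strict flip: sum_distrib_left)
  finally have "norm (\<Sum>t\<in>{1..Y}. addchar m (int t * k)) = norm (1 - ?z ^ Y) / norm (1 - ?z)"
    by (simp add: norm_divide norm_mult)
  also have "\<dots> \<le> 2 / norm (1 - ?z)"
    using norm_triangle_ineq4[of 1 "?z ^ Y"] by (intro divide_right_mono) (auto simp: norm_power)
  also have "\<dots> \<le> 2 / (4 * real_of_int \<bar>k cmod int m\<bar> / real m)"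
    using norm_addchar_minus_1_ge[OF assms(1), of k] pos z
    by (intro divide_left_mono mult_pos_pos) auto
  finally show ?thesis by simp
qed

section \<open>The variance of products over residue classes\<close>

lemma card_bounded_ints_in_class_le:
  fixes c :: int and m W :: nat
  assumes "m > 0"
  shows "finite {n::int. \<bar>n\<bar> \<le> int (W * m) \<and> [n = c] (mod int m)}"
    and "card {n::int. \<bar>n\<bar> \<le> int (W * m) \<and> [n = c] (mod int m)} \<le> 2 * W + 1"
proof -
  let ?S = "{n::int. \<bar>n\<bar> \<le> int (W * m) \<and> [n = c] (mod int m)}"
  have inj: "inj_on (\<lambda>n. n div int m) ?S"
  proof (rule inj_onI)
    fix n n' assume "n \<in> ?S" "n' \<in> ?S" and div: "n div int m = n' div int m"
    then have "n mod int m = n' mod int m" by (auto simp: cong_def)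
    with div show "n = n'" by (metis div_mult_mod_eq)
  qed
  have sub: "(\<lambda>n. n div int m) ` ?S \<subseteq> {- int W..int W}"
  proof (rule image_subsetI)
    fix n assume "n \<in> ?S"
    then have "(- int W) * int m \<le> n" "n \<le> int W * int m" by auto
    then have "(- int W) * int m div int m \<le> n div int m" "n div int m \<le> int W * int m div int m"
      using assms by (intro zdiv_mono1; simp)+
    moreover have "(- int W) * int m div int m = - int W" "int W * int m div int m = int W"
      using assms by (intro nonzero_mult_div_cancel_right; simp)+
    ultimately show "n div int m \<in> {- int W..int W}" by simp
  qed
  show "finite ?S" using inj sub finite_imageD finite_subset by blast
  have "card ?S \<le> card {- int W..int W}"
    using inj sub by (intro card_inj_on_le) auto
  then show "card ?S \<le> 2 * W + 1" by simp
qed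

text \<open>
  The product \<open>r u\<close> takes at most \<open>2 W + 1\<close> values, and each value, being nonzero, is attained at most
  once for every one of its positive divisors \<open>r\<close>.
\<close>
lemma card_factorizations_in_class_le:
  fixes c :: int and m W T :: nat
  assumes "m > 0" and T: "\<And>k::nat. 0 < k \<Longrightarrow> k \<le> W * m \<Longrightarrow> card {d. d dvd k} \<le> T"
  defines "S \<equiv> {(r::nat, u::int). r > 0 \<and> u \<noteq> 0 \<and> int r * \<bar>u\<bar> \<le> int (W * m) \<and> [int r * u = c] (mod int m)}"
  shows "finite S" "card S \<le> (2 * W + 1) * T"
proof -
  define N where "N = {n::int. \<bar>n\<bar> \<le> int (W * m) \<and> [n = c] (mod int m)} - {0}"
  let ?D = "SIGMA n:N. {d. d dvd nat \<bar>n\<bar>}"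
  note cls = card_bounded_ints_in_class_le[OF assms(1), of W c]
  have N: "finite N" "card N \<le> 2 * W + 1"
    using cls card_Diff1_le[of _ 0] unfolding N_def by (auto intro: le_trans)
  have findiv: "finite {d. d dvd nat \<bar>n\<bar>}" if "n \<in> N" for n
    using that by (intro finite_divisors_nat) (auto simp: N_def)
  then have fin: "finite ?D" using N(1) by (intro finite_SigmaI)
  have inj: "inj_on (\<lambda>(r, u). (int r * u, r)) S" by (auto simp: inj_on_def S_def)
  have sub: "(\<lambda>(r, u). (int r * u, r)) ` S \<subseteq> ?D"
    by (auto simp: S_def N_def abs_mult nat_mult_distrib)
  show "finite S" using inj sub fin finite_imageD finite_subset by blast
  have "card S \<le> card ?D" using inj sub fin by (intro card_inj_on_le)
  also have "\<dots> = (\<Sum>n\<in>N. card {d. d dvd nat \<bar>n\<bar>})"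
    using N(1) findiv by (intro card_SigmaI) blast+
  also have "\<dots> \<le> (\<Sum>n\<in>N. T)" by (intro sum_mono T) (auto simp: N_def nat_le_iff)
  also have "\<dots> = card N * T" by simp
  also have "\<dots> \<le> (2 * W + 1) * T" using N(2) by (rule mult_le_mono1)
  finally show "card S \<le> (2 * W + 1) * T" .
qed

text \<open>
  Replacing \<open>r\<close> by \<open>r mod m\<close>, which loses only the block \<open>r div m\<close>, keeps the products within \<open>W * m\<close>
  even if \<open>x\<close> is much larger than \<open>m\<close>. The number of factorizations is then controlled in terms
  of \<open>m\<close> alone, and this is why the final estimate is uniform in \<open>x\<close>.
\<close>
lemma card_products_in_class_le:
  fixes c :: int and m W T :: nat and x Z :: real and R :: "nat set"
  assumes m: "m > 1" and R: "\<And>r. r \<in> R \<Longrightarrow> 1 \<le> r \<and> real r \<le> x \<and> coprime r m"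
    and W: "W > 0"
    and T: "\<And>k::nat. 0 < k \<Longrightarrow> k \<le> W * m \<Longrightarrow> card {d. d dvd k} \<le> T"
    and x: "x > 0"
  defines "Z \<equiv> min x (real m)"
  defines "U \<equiv> {(r, u::int). r \<in> R \<and> u \<noteq> 0 \<and> real_of_int \<bar>u\<bar> \<le> real W * real m / Z \<and> [int r * u = c] (mod int m)}"
  shows "finite U" "real (card U) \<le> 6 * x * real W * real T / Z"
proof -
  define S where "S = {(r::nat, u::int). r > 0 \<and> u \<noteq> 0 \<and> int r * \<bar>u\<bar> \<le> int (W * m) \<and> [int r * u = c] (mod int m)}"
  let ?f = "\<lambda>(r, u). (r div m, r mod m, u)"
  define B where "B = nat \<lfloor>x / real m\<rfloor>"
  have Z: "Z > 0" "Z \<le> x" "Z \<le> real m" using m x by (auto simp: Z_def)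
  have S: "finite S" "card S \<le> (2 * W + 1) * T"
    using card_factorizations_in_class_le[of m W T c] m T unfolding S_def by auto
  have inj: "inj_on ?f U"
    by (auto simp: inj_on_def) (metis div_mult_mod_eq)
  have sub: "?f ` U \<subseteq> {..B} \<times> S"
  proof (rule image_subsetI)
    fix z assume "z \<in> U"
    then obtain r u where z: "z = (r, u)" and ru: "r \<in> R" "u \<noteq> 0"
      "real_of_int \<bar>u\<bar> \<le> real W * real m / Z" "[int r * u = c] (mod int m)"
      by (auto simp: U_def)
    have "r mod m > 0"
    proof (rule ccontr)
      assume "\<not> r mod m > 0"
      then have "m dvd r" by auto
      then have "m dvd 1" using R[OF ru(1)] by (metis coprime_common_divisor dvd_refl)
      then show False using m by simp
    qed
    moreover have "int (r mod m) * \<bar>u\<bar> \<le> int (W * m)"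
    proof -
      have "real (r mod m) \<le> real r" by (intro of_nat_mono mod_less_eq_dividend)
      then have "real (r mod m) \<le> x" using R[OF ru(1)] by linarith
      moreover have "real (r mod m) \<le> real m" using m by (simp add: less_imp_le)
      ultimately have "real (r mod m) \<le> Z" by (simp add: Z_def)
      then have "real (r mod m) * real_of_int \<bar>u\<bar> \<le> Z * (real W * real m / Z)"
        using ru(3) Z by (intro mult_mono) auto
      also have "\<dots> = real W * real m" using Z by simp
      finally have "real_of_int (int (r mod m) * \<bar>u\<bar>) \<le> real_of_int (int (W * m))" by simp
      then show ?thesis by (simp only: of_int_le_iff)
    qed
    moreover have "[int (r mod m) * u = c] (mod int m)"
    proof -
      have "[int (r mod m) * u = int r * u] (mod int m)"
        by (intro cong_mult cong_refl) (simp add: cong_def zmod_int)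
      then show ?thesis using ru(4) cong_trans by blast
    qed
    moreover have "r div m \<le> B"
    proof -
      have "real (r div m) * real m \<le> real r"
        using div_times_less_eq_dividend[of r m] by (simp flip: of_nat_mult)
      then have "real (r div m) \<le> real r / real m" using m by (simp add: pos_le_divide_eq)
      also have "\<dots> \<le> x / real m" using R[OF ru(1)] by (intro divide_right_mono) auto
      finally show ?thesis unfolding B_def by (simp add: le_nat_floor)
    qed
    ultimately show "?f z \<in> {..B} \<times> S" using ru(2) by (simp add: z S_def)
  qed
  have fin: "finite ({..B} \<times> S)" using S by simp
  show "finite U" using inj sub fin finite_imageD finite_subset by blast
  have "card U \<le> card ({..B} \<times> S)" using inj sub fin by (rule card_inj_on_le)
  also have "\<dots> = (B + 1) * card S" by (simp add: card_cartesian_product)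
  also have "\<dots> \<le> (B + 1) * ((2 * W + 1) * T)" using S(2) by (rule mult_le_mono2)
  finally have "real (card U) \<le> real ((B + 1) * ((2 * W + 1) * T))" by (simp only: of_nat_le_iff)
  also have "\<dots> = (real B + 1) * ((2 * real W + 1) * real T)" by (simp add: algebra_simps)
  also have "\<dots> \<le> (2 * x / Z) * ((3 * real W) * real T)"
  proof (intro mult_mono)
    \<comment> \<open>There are \<open>B + 1\<close> blocks: a single one if \<open>x < m\<close>, and at most \<open>2 x / m\<close> otherwise.\<close>
    show "real B + 1 \<le> 2 * x / Z"
    proof (cases "x < real m")
      case True
      then have "\<lfloor>x / real m\<rfloor> = 0" using x by (simp add: floor_eq_iff)
      then show ?thesis using True x by (simp add: B_def Z_def)
    next
      case False
      then have "1 \<le> x / real m" "Z = real m" using m by (auto simp: Z_def)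
      moreover have "real B \<le> x / real m" using x unfolding B_def by simp
      ultimately show ?thesis by simp
    qed
    show "2 * real W + 1 \<le> 3 * real W" using W by linarith
  qed (use x Z in auto)
  finally show "real (card U) \<le> 6 * x * real W * real T / Z" by simp
qed

lemma card_nonzero_ints_le:
  assumes "K \<ge> 0"
  shows "finite {v::int. v \<noteq> 0 \<and> real_of_int \<bar>v\<bar> \<le> K}"
    and "real (card {v::int. v \<noteq> 0 \<and> real_of_int \<bar>v\<bar> \<le> K}) \<le> 2 * K"
proof -
  define k where "k = nat \<lfloor>K\<rfloor>"
  have k: "real k \<le> K" using assms by (simp add: k_def)
  have sub: "{v::int. v \<noteq> 0 \<and> real_of_int \<bar>v\<bar> \<le> K} \<subseteq> {-int k..-1} \<union> {1..int k}"
  proof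
    fix v :: int assume "v \<in> {v. v \<noteq> 0 \<and> real_of_int \<bar>v\<bar> \<le> K}"
    then have v: "v \<noteq> 0" "\<bar>v\<bar> \<le> \<lfloor>K\<rfloor>" by (auto simp: le_floor_iff)
    then show "v \<in> {-int k..-1} \<union> {1..int k}" using assms unfolding k_def by auto
  qed
  then show "finite {v::int. v \<noteq> 0 \<and> real_of_int \<bar>v\<bar> \<le> K}" by (rule finite_subset) simp
  have "card {v::int. v \<noteq> 0 \<and> real_of_int \<bar>v\<bar> \<le> K} \<le> card ({-int k..-1} \<union> {1..int k})"
    using sub by (intro card_mono) auto
  also have "\<dots> = 2 * k" by (subst card_Un_disjoint) auto
  finally show "real (card {v::int. v \<noteq> 0 \<and> real_of_int \<bar>v\<bar> \<le> K}) \<le> 2 * K" using k by linarith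
qed

text \<open>
  The left-hand side counts triples \<open>(h, r1, r2)\<close> such that \<open>u \<equiv> h c r1\<close> and \<open>v \<equiv> h c r2\<close> are small. These
  satisfy \<open>r2 u \<equiv> r1 v\<close>, and \<open>h\<close> can be recovered from \<open>u\<close> and \<open>r1\<close>. So it suffices to choose
  \<open>r1\<close> and \<open>v\<close> freely and then \<open>(r2, u)\<close> with product in the class of \<open>r1 v\<close>.
\<close>
lemma sum_squared_close_counts_le:
  fixes R :: "nat set" and m c :: nat and K M :: real
  assumes m: "m > 1" and c: "coprime c m" and fin: "finite R"
    and R: "\<And>r. r \<in> R \<Longrightarrow> coprime r m" and K: "K \<ge> 0"
    and M: "\<And>b. finite {(r, u::int). r \<in> R \<and> u \<noteq> 0 \<and> real_of_int \<bar>u\<bar> \<le> K \<and> [int r * u = b] (mod int m)}"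
      "\<And>b. real (card {(r, u::int). r \<in> R \<and> u \<noteq> 0 \<and> real_of_int \<bar>u\<bar> \<le> K \<and> [int r * u = b] (mod int m)}) \<le> M"
  shows "(\<Sum>h\<in>{1..<m}. (real (card {r \<in> R. real_of_int \<bar>(int h * int (c * r)) cmod int m\<bar> \<le> K}))\<^sup>2)
    \<le> real (card R) * (2 * K) * M"
proof -
  define G where "G = (\<lambda>b. {(r, u::int). r \<in> R \<and> u \<noteq> 0 \<and> real_of_int \<bar>u\<bar> \<le> K \<and> [int r * u = b] (mod int m)})"
  define s where "s = (\<lambda>h r. (int h * int (c * r)) cmod int m)"
  define B where "B = (\<lambda>h. {r \<in> R. real_of_int \<bar>s h r\<bar> \<le> K})"
  define V where "V = {v::int. v \<noteq> 0 \<and> real_of_int \<bar>v\<bar> \<le> K}"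
  let ?H = "SIGMA h:{1..<m}. B h \<times> B h"
  let ?D = "SIGMA p:R \<times> V. G (int (fst p) * snd p)"
  let ?f = "\<lambda>(h, r1, r2). ((r1, s h r2), (r2, s h r1))"
  have V: "finite V" "real (card V) \<le> 2 * K" using card_nonzero_ints_le[OF K] by (auto simp: V_def)
  have finB: "finite (B h)" for h using fin by (simp add: B_def)
  have scong: "[s h r = int h * int (c * r)] (mod int m)" for h r
    unfolding s_def by (rule cong_centered_modulo)
  have cop: "coprime (int (c * r)) (int m)" if "r \<in> R" for r
    using R[OF that] c by simp
  have snz: "s h r \<noteq> 0" if "r \<in> R" "h \<in> {1..<m}" for h r
    using centered_modulo_unit_multiple_nonzero[of h m "c * r"] that R c by (simp add: s_def)
  have inj: "inj_on ?f ?H"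
  proof (rule inj_onI, clarsimp simp: B_def)
    fix h h' r1 
    assume r1: "r1 \<in> R" and h: "Suc 0 \<le> h" "h < m" "Suc 0 \<le> h'" "h' < m" and eq: "s h r1 = s h' r1"
    have "[int h * int (c * r1) = int h' * int (c * r1)] (mod int m)"
      using scong[of h r1] scong[of h' r1] eq by (metis cong_sym cong_trans)
    then have "[int h = int h'] (mod int m)"
      using cop[OF r1] cong_mult_rcancel by blast
    then show "h = h'" using h by (simp add: cong_int_iff cong_less_modulus_unique_nat)
  qed
  have sub: "?f ` ?H \<subseteq> ?D"
  proof (clarsimp simp: B_def V_def G_def)
    fix h r1 r2
    assume *: "Suc 0 \<le> h" "h < m" "r1 \<in> R" "r2 \<in> R"
    have "[int r2 * s h r1 = int r2 * (int h * int (c * r1))] (mod int m)"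
      "[int r1 * s h r2 = int r1 * (int h * int (c * r2))] (mod int m)"
      using scong by (auto intro: cong_mult cong_refl)
    moreover have "int r2 * (int h * int (c * r1)) = int r1 * (int h * int (c * r2))" by simp
    ultimately have "[int r2 * s h r1 = int r1 * s h r2] (mod int m)"
      by (metis cong_sym cong_trans)
    then show "s h r2 \<noteq> 0 \<and> s h r1 \<noteq> 0 \<and> [int r2 * s h r1 = int r1 * s h r2] (mod int m)"
      using snz * by auto
  qed
  have finD: "finite ?D" using fin V M(1) by (auto simp: G_def)
  have "(\<Sum>h\<in>{1..<m}. (real (card (B h)))\<^sup>2) = real (card ?H)"
    using finB by (simp add: card_SigmaI card_cartesian_product power2_eq_square)
  also have "\<dots> \<le> real (card ?D)"
    using card_inj_on_le[OF inj sub finD] by simp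
  also have "\<dots> = (\<Sum>p\<in>R \<times> V. real (card (G (int (fst p) * snd p))))"
    using fin V M(1) by (subst card_SigmaI) (auto simp: G_def)
  also have "\<dots> \<le> (\<Sum>p\<in>R \<times> V. M)"
    using M(2) unfolding G_def by (intro sum_mono)
  also have "\<dots> = real (card R) * real (card V) * M" by (simp add: card_cartesian_product)
  also have "\<dots> \<le> real (card R) * (2 * K) * M"
    using V M(2)[of 0] by (intro mult_right_mono mult_left_mono) (auto intro: order_trans[rotated])
  finally show ?thesis unfolding B_def s_def .
qed

text \<open>
  A pointwise bound for the Dirichlet kernel by level sets. Here \<open>v\<close> is the absolute value of the centered
  residue: the kernel is at most \<open>Z / 2 ^ i\<close> unless \<open>v\<close> is within \<open>2 ^ i\<close> times \<open>m / Z\<close>,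
  and the levels up to \<open>L\<close> exhaust all \<open>v \<le> m / 2\<close>.
\<close>
lemma min_le_dyadic_sum:
  fixes Z v m :: real
  assumes "Z > 0" "v > 0" "2 * v \<le> m" "Z \<le> 2 ^ L"
  shows "min Z (m / (2 * v)) \<le> (\<Sum>i\<le>L. if v \<le> 2 ^ i * m / Z then Z / 2 ^ i else 0)"
proof -
  let ?P = "\<lambda>i. v \<le> 2 ^ i * m / Z"
  have "v * Z \<le> m * 2 ^ L" using assms by (intro mult_mono) auto
  then have PL: "?P L" using assms by (simp add: field_simps)
  define i where "i = (LEAST i. ?P i)"
  have Pi: "?P i" and iL: "i \<le> L" using PL unfolding i_def by (auto intro: LeastI Least_le)
  have "min Z (m / (2 * v)) \<le> Z / 2 ^ i"
  proof (cases i)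
    case 0
    then show ?thesis by simp
  next
    case (Suc j)
    have "\<not> ?P j" using Suc not_less_Least[of j ?P] unfolding i_def by simp
    then have "m / (2 * v) \<le> Z / 2 ^ i" using assms Suc by (simp add: field_simps)
    then show ?thesis by simp
  qed
  also have "\<dots> = (if ?P i then Z / 2 ^ i else 0)" using Pi by simp
  also have "\<dots> \<le> (\<Sum>i\<le>L. if ?P i then Z / 2 ^ i else 0)"
    using iL assms by (intro member_le_sum) auto
  finally show ?thesis .
qed

text \<open>
  At level \<open>i\<close> the kernel has size \<open>Z / 2 ^ i\<close> on the residues of size at most \<open>K i = 2 ^ i m / Z\<close>, and the
  number of pairs of such residues grows like \<open>4 ^ i\<close>. The powers of 2 cancel, so that all
  levels have the same bound, a multiple of \<open>T n x\<close>, and only a factor \<open>(L + 1)\<^sup>2\<close> is lost.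
\<close>
lemma residue_variance_le:
  fixes R :: "nat set" and m c Y L T :: nat and x :: real
  assumes m: "m > 0" and c: "coprime c m" and fin: "finite R"
    and R: "\<And>r. r \<in> R \<Longrightarrow> 1 \<le> r \<and> real r \<le> x \<and> coprime r m"
    and x: "x > 0" and Y: "real Y \<le> x" and L: "m \<le> 2 ^ L"
    and T: "\<And>k::nat. 0 < k \<Longrightarrow> k \<le> 2 ^ L * m \<Longrightarrow> card {d. d dvd k} \<le> T"
  shows "(\<Sum>a\<in>{1..m}. (real (card {(r, t). r \<in> R \<and> t \<in> {1..Y} \<and> [c * r * t = a] (mod m)})
      - real (card R) * real Y / real m)\<^sup>2) \<le> 12 * (real L + 1)\<^sup>2 * real T * real (card R) * x"
    (is "?V \<le> ?bound")
proof (cases "m = 1")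
  case True
  have "{(r, t). r \<in> R \<and> t \<in> {1..Y}} = R \<times> {1..Y}" by auto
  then show ?thesis using True x by (simp add: card_cartesian_product)
next
  case False
  then have m1: "m > 1" using m by simp
  \<comment> \<open>The kernel is bounded by \<open>Y \<le> x\<close> and, at nonzero residues, by \<open>m / 2\<close>; so by \<open>Z\<close>.\<close>
  define Z where "Z = min x (real m)"
  define n where "n = real (card R)"
  define K where "K = (\<lambda>i::nat. 2 ^ i * real m / Z)"
  define s where "s = (\<lambda>h r. (int h * int (c * r)) cmod int m)"
  define B where "B = (\<lambda>i h. {r \<in> R. real_of_int \<bar>s h r\<bar> \<le> K i})"
  define g where "g = (\<lambda>(r, t). c * r * t)"
  define F where "F = (\<lambda>h. \<Sum>p\<in>R \<times> {1..Y}. addchar m (int h * int (g p)))"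
  have Z: "Z > 0" using x m by (simp add: Z_def)
  have ZL: "Z \<le> 2 ^ L"
  proof -
    have "Z \<le> real m" by (simp add: Z_def)
    also have "\<dots> \<le> 2 ^ L" using L by (metis of_nat_le_iff of_nat_numeral of_nat_power)
    finally show ?thesis .
  qed
  have kernel: "norm (\<Sum>t\<in>{1..Y}. addchar m (int t * (int h * int (c * r))))
      \<le> (\<Sum>i\<le>L. if real_of_int \<bar>s h r\<bar> \<le> K i then Z / 2 ^ i else 0)"
    if h: "h \<in> {1..<m}" and r: "r \<in> R" for h r
  proof -
    let ?D = "norm (\<Sum>t\<in>{1..Y}. addchar m (int t * (int h * int (c * r))))"
    have nz: "s h r \<noteq> 0"
      using centered_modulo_unit_multiple_nonzero[of h m "c * r"] h R[OF r] c by (simp add: s_def)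
    let ?v = "real_of_int \<bar>s h r\<bar>"
    have v1: "?v \<ge> 1" using nz by (simp flip: of_int_abs)
    have "real_of_int (2 * \<bar>s h r\<bar>) \<le> real_of_int (int m)"
      using abs_centered_modulo_le[of "int m"] m unfolding s_def by (subst of_int_le_iff) simp
    then have v2: "2 * ?v \<le> real m" by simp
    have 1: "?D \<le> real m / (2 * ?v)"
      using norm_sum_addchar_le[OF m nz[unfolded s_def], of Y] by (simp add: s_def)
    have "?D \<le> (\<Sum>t\<in>{1..Y}. 1)" by (rule order_trans[OF norm_sum]) simp
    then have 2: "?D \<le> x" using Y by simp
    have "real m / (2 * ?v) \<le> real m / 1" using v1 by (intro divide_left_mono) auto
    then have "?D \<le> min Z (real m / (2 * ?v))" using 1 2 by (simp add: Z_def)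
    also have "\<dots> \<le> (\<Sum>i\<le>L. if ?v \<le> 2 ^ i * real m / Z then Z / 2 ^ i else 0)"
      using Z v1 v2 ZL by (intro min_le_dyadic_sum) auto
    finally show ?thesis by (simp add: K_def)
  qed
  have F: "norm (F h) \<le> (\<Sum>i\<le>L. Z / 2 ^ i * real (card (B i h)))" if h: "h \<in> {1..<m}" for h
  proof -
    have "F h = (\<Sum>r\<in>R. \<Sum>t\<in>{1..Y}. addchar m (int t * (int h * int (c * r))))"
      unfolding F_def g_def by (subst sum.cartesian_product) (auto intro!: sum.cong simp: mult_ac)
    then have "norm (F h) \<le> (\<Sum>r\<in>R. norm (\<Sum>t\<in>{1..Y}. addchar m (int t * (int h * int (c * r)))))"
      by (simp add: norm_sum)
    also have "\<dots> \<le> (\<Sum>r\<in>R. \<Sum>i\<le>L. if real_of_int \<bar>s h r\<bar> \<le> K i then Z / 2 ^ i else 0)"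
      using kernel[OF h] by (intro sum_mono)
    also have "\<dots> = (\<Sum>i\<le>L. \<Sum>r\<in>R. if real_of_int \<bar>s h r\<bar> \<le> K i then Z / 2 ^ i else 0)"
      by (rule sum.swap)
    also have "\<dots> = (\<Sum>i\<le>L. Z / 2 ^ i * real (card (B i h)))"
      using fin by (intro sum.cong refl) (simp add: sum.If_cases B_def Int_def mult.commute)
    finally show ?thesis .
  qed
  have level: "(\<Sum>h\<in>{1..<m}. (real (card (B i h)))\<^sup>2) \<le> n * (2 * K i) * (6 * x * 2 ^ i * real T / Z)"
    if "i \<le> L" for i
  proof -
    have "T' \<le> T" if "T' = card {d. d dvd k}" "0 < k" "k \<le> 2 ^ i * m" for k T' :: nat
    proof -
      have "(2::nat) ^ i * m \<le> 2 ^ L * m" using \<open>i \<le> L\<close> by simp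
      then show ?thesis using T[of k] that by linarith
    qed
    then have *: "\<And>k::nat. 0 < k \<Longrightarrow> k \<le> 2 ^ i * m \<Longrightarrow> card {d. d dvd k} \<le> T" by blast
    have Ki: "real (2 ^ i) * real m / Z = K i" by (simp add: K_def)
    show ?thesis unfolding B_def s_def n_def
      using card_products_in_class_le[of m R x "2 ^ i" T, OF m1 R _ * x, folded Z_def, unfolded Ki]
        Z R K_def
      by (intro sum_squared_close_counts_le m1 c fin) auto
  qed
  have "real m * ?V = (\<Sum>h\<in>{1..<m}. (norm (F h))\<^sup>2)"
  proof -
    have "{(r, t). r \<in> R \<and> t \<in> {1..Y} \<and> [c * r * t = a] (mod m)}
        = {p \<in> R \<times> {1..Y}. [g p = a] (mod m)}" for a
      by (auto simp: g_def)
    then show ?thesis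
      using residue_counts_parseval[of m "R \<times> {1..Y}" g] m fin
      by (simp add: F_def card_cartesian_product)
  qed
  also have "\<dots> \<le> (\<Sum>h\<in>{1..<m}. \<Sum>i\<le>L. (real L + 1) * (Z / 2 ^ i * real (card (B i h)))\<^sup>2)"
  proof (rule sum_mono)
    fix h assume h: "h \<in> {1..<m}"
    have "(norm (F h))\<^sup>2 \<le> (\<Sum>i\<le>L. Z / 2 ^ i * real (card (B i h)))\<^sup>2"
      using F[OF h] by (intro power_mono) auto
    also have "\<dots> \<le> (\<Sum>i\<le>L. (Z / 2 ^ i * real (card (B i h)))\<^sup>2) * real (card {..L})"
      by (rule sum_squared_le_sum_of_squares)
    finally show "(norm (F h))\<^sup>2 \<le> (\<Sum>i\<le>L. (real L + 1) * (Z / 2 ^ i * real (card (B i h)))\<^sup>2)"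
      by (simp add: sum_distrib_left[symmetric] mult.commute add.commute)
  qed
  also have "\<dots> = (\<Sum>i\<le>L. \<Sum>h\<in>{1..<m}. (real L + 1) * (Z / 2 ^ i * real (card (B i h)))\<^sup>2)"
    by (rule sum.swap)
  also have "\<dots> = (\<Sum>i\<le>L. (real L + 1) * (Z / 2 ^ i)\<^sup>2 * (\<Sum>h\<in>{1..<m}. (real (card (B i h)))\<^sup>2))"
    by (simp only: sum_distrib_left power_mult_distrib mult_ac)
  also have "\<dots> \<le> (\<Sum>i\<le>L. (real L + 1) * (Z / 2 ^ i)\<^sup>2 * (n * (2 * K i) * (6 * x * 2 ^ i * real T / Z)))"
    using level by (intro sum_mono mult_left_mono) auto
  also have "\<dots> = (\<Sum>i\<le>L. (real L + 1) * (12 * real T * n * x * real m))"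
    using Z by (intro sum.cong refl) (simp add: K_def field_simps power2_eq_square)
  also have "\<dots> = real m * ?bound" by (simp add: n_def power2_eq_square)
  finally show ?thesis using m by simp
qed

section \<open>From all integers to squarefree integers\<close>

text \<open>
  Cauchy--Schwarz over the \<open>m\<close> residue classes. Passing from the integer part of \<open>y\<close> to \<open>y\<close> in the main term
  costs at most \<open>card R\<close> in total, which is admissible because \<open>card R \<le> x\<close>. The bound is linear in \<open>T\<close>,
  where the variance gives its square root; since divisor counts are smaller than any power of \<open>m\<close>, this is harmless.
\<close>
lemma residue_discrepancy_le:
  fixes R :: "nat set" and m c L T :: nat and x y :: real
  assumes m: "m > 0" and c: "coprime c m" and fin: "finite R"
    and R: "\<And>r. r \<in> R \<Longrightarrow> 1 \<le> r \<and> real r \<le> x \<and> coprime r m"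
    and x: "x > 0" and y: "0 \<le> y" "y \<le> x" and L: "m \<le> 2 ^ L"
    and T: "\<And>k::nat. 0 < k \<Longrightarrow> k \<le> 2 ^ L * m \<Longrightarrow> card {d. d dvd k} \<le> T"
  shows "(\<Sum>a\<in>{1..m}. \<bar>real (card {(r, t). r \<in> R \<and> t \<in> {1..nat \<lfloor>y\<rfloor>} \<and> [c * r * t = a] (mod m)})
      - real (card R) * y / real m\<bar>) \<le> 5 * (real L + 1) * real T * sqrt (real m * (real (card R) * x))"
    (is "?S \<le> _")
proof -
  define n where "n = real (card R)"
  define Y where "Y = nat \<lfloor>y\<rfloor>"
  define N where "N = (\<lambda>a. real (card {(r, t). r \<in> R \<and> t \<in> {1..Y} \<and> [c * r * t = a] (mod m)}))"
  have Y: "real Y \<le> y" "y \<le> real Y + 1" using y unfolding Y_def by linarith+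
  have T1: "T \<ge> 1" using T[of 1] m by simp
  have nx: "n \<le> x"
  proof -
    have "R \<subseteq> {1..nat \<lfloor>x\<rfloor>}"
    proof
      fix r assume "r \<in> R"
      then show "r \<in> {1..nat \<lfloor>x\<rfloor>}" using R[of r] by (auto simp: le_nat_floor)
    qed
    then have "card R \<le> card {1..nat \<lfloor>x\<rfloor>}" by (intro card_mono) auto
    then have "real (card R) \<le> real (nat \<lfloor>x\<rfloor>)" by simp
    also have "\<dots> \<le> x" using x by simp
    finally show ?thesis by (simp add: n_def)
  qed
  let ?q = "real m * (n * x)"
  have q0: "?q \<ge> 0" using x by (simp add: n_def)
  have "(\<Sum>a\<in>{1..m}. (N a - n * real Y / real m)\<^sup>2) \<le> 12 * (real L + 1)\<^sup>2 * real T * n * x"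
    using residue_variance_le[OF m c fin R x _ L T, of Y] Y y unfolding N_def n_def by simp
  then have "real m * (\<Sum>a\<in>{1..m}. (N a - n * real Y / real m)\<^sup>2)
      \<le> real m * (12 * (real L + 1)\<^sup>2 * real T * n * x)" by (intro mult_left_mono) auto
  also have "\<dots> = real T * (12 * (real L + 1)\<^sup>2 * ?q)" by (simp add: mult_ac)
  also have "\<dots> \<le> (real T)\<^sup>2 * (16 * (real L + 1)\<^sup>2 * ?q)"
    using T1 q0 by (intro mult_mono mult_right_mono) (auto simp: power2_eq_square)
  finally have var: "real m * (\<Sum>a\<in>{1..m}. (N a - n * real Y / real m)\<^sup>2)
      \<le> (real T)\<^sup>2 * (16 * (real L + 1)\<^sup>2 * ?q)" .
  have "(\<Sum>a\<in>{1..m}. \<bar>N a - n * real Y / real m\<bar>)\<^sup>2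
      \<le> (\<Sum>a\<in>{1..m}. \<bar>N a - n * real Y / real m\<bar>\<^sup>2) * real (card {1..m})"
    by (rule sum_squared_le_sum_of_squares)
  also have "\<dots> \<le> (4 * (real L + 1) * real T * sqrt ?q)\<^sup>2"
  proof -
    have e: "(4 * (real L + 1) * real T * sqrt ?q)\<^sup>2 = (real T)\<^sup>2 * (16 * (real L + 1)\<^sup>2 * ?q)"
      using q0 by (simp only: power_mult_distrib real_sqrt_pow2) simp
    show ?thesis unfolding e using var by (simp add: mult.commute)
  qed
  finally have 1: "(\<Sum>a\<in>{1..m}. \<bar>N a - n * real Y / real m\<bar>) \<le> 4 * (real L + 1) * real T * sqrt ?q"
    by (rule power2_le_imp_le) (use q0 in auto)
  have "n\<^sup>2 \<le> ?q"
  proof -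
    have "n * n \<le> n * x" using nx by (intro mult_left_mono) (auto simp: n_def)
    also have "\<dots> \<le> real m * (n * x)"
      using m x mult_right_mono[of 1 "real m" "n * x"] by (simp add: n_def)
    finally show ?thesis by (simp add: power2_eq_square)
  qed
  then have "n \<le> sqrt ?q" by (rule real_le_rsqrt)
  also have "\<dots> \<le> (real L + 1) * real T * sqrt ?q"
  proof -
    have "1 * 1 \<le> (real L + 1) * real T" using T1 by (intro mult_mono) auto
    then show ?thesis using q0 mult_right_mono[of 1 "(real L + 1) * real T" "sqrt ?q"] by simp
  qed
  finally have 2: "n \<le> (real L + 1) * real T * sqrt ?q" .
  have "?S = (\<Sum>a\<in>{1..m}. \<bar>N a - n * y / real m\<bar>)" by (simp add: N_def n_def Y_def)
  also have "\<dots> \<le> (\<Sum>a\<in>{1..m}. \<bar>N a - n * real Y / real m\<bar> + n / real m)"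
  proof (rule sum_mono)
    fix a
    have "n * real Y \<le> n * y" "n * y \<le> n * real Y + n"
      using Y mult_left_mono[of y "real Y + 1" n] by (auto simp: n_def distrib_left intro: mult_left_mono)
    then have "n * real Y / real m \<le> n * y / real m" "n * y / real m \<le> n * real Y / real m + n / real m"
      by (auto simp: add_divide_distrib[symmetric] intro: divide_right_mono)
    then show "\<bar>N a - n * y / real m\<bar> \<le> \<bar>N a - n * real Y / real m\<bar> + n / real m" by linarith
  qed
  also have "\<dots> = (\<Sum>a\<in>{1..m}. \<bar>N a - n * real Y / real m\<bar>) + n" using m by (simp add: sum.distrib)
  finally show ?thesis using 1 2 by (simp add: n_def algebra_simps)
qed

lemma residue_discrepancy_trivial:
  fixes R :: "nat set" and m c :: nat and y :: real
  assumes m: "m > 0" and fin: "finite R" and y: "0 \<le> y"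
  shows "(\<Sum>a\<in>{1..m}. \<bar>real (card {(r, t). r \<in> R \<and> t \<in> {1..nat \<lfloor>y\<rfloor>} \<and> [c * r * t = a] (mod m)})
      - real (card R) * y / real m\<bar>) \<le> 2 * (real (card R) * y)"
    (is "?S \<le> _")
proof -
  let ?Y = "nat \<lfloor>y\<rfloor>"
  define N where "N = (\<lambda>a. card {(r, t). r \<in> R \<and> t \<in> {1..?Y} \<and> [c * r * t = a] (mod m)})"
  have "{(r, t). r \<in> R \<and> t \<in> {1..?Y} \<and> [c * r * t = a] (mod m)}
      = {p \<in> R \<times> {1..?Y}. [(\<lambda>(r, t). c * r * t) p = a] (mod m)}" for a by auto
  then have N: "(\<Sum>a\<in>{1..m}. N a) = card R * ?Y"
    using sum_residue_counts[OF m, of "R \<times> {1..?Y}" "\<lambda>(r, t). c * r * t"] fin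
    by (simp add: N_def card_cartesian_product)
  have "?S = (\<Sum>a\<in>{1..m}. \<bar>real (N a) - real (card R) * y / real m\<bar>)" by (simp add: N_def)
  also have "\<dots> \<le> (\<Sum>a\<in>{1..m}. real (N a) + real (card R) * y / real m)"
    using y by (intro sum_mono order_trans[OF abs_triangle_ineq4]) simp
  also have "\<dots> = real (card R) * real ?Y + real (card R) * y"
    unfolding sum.distrib of_nat_sum[symmetric] N using m by simp
  also have "\<dots> \<le> real (card R) * y + real (card R) * y"
    using y by (intro add_right_mono mult_left_mono) auto
  finally show ?thesis by (simp only: mult_2)
qed

text \<open>
  If \<open>a\<close> is prime to \<open>m\<close>, then so is every \<open>s\<close> that is counted, hence also every \<open>d\<close> with \<open>d\<^sup>2 dvd s\<close>. Thus
  only \<open>d\<close> prime to \<open>m\<close> occur, and this is the source of the Euler product in \<open>vartheta\<close>.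
\<close>
lemma Q_eq_moebius_sum:
  fixes R :: "nat set" and m M a :: nat and x :: real
  assumes fin: "finite R" and x: "x \<ge> 0" and M: "x < (real M + 1)\<^sup>2" and a: "coprime a m"
  shows "real (Q R x m a) = (\<Sum>d | d \<in> {1..M} \<and> coprime d m. moebius d *
    real (card {(r, t). r \<in> R \<and> t \<in> {1..nat \<lfloor>x / (real d)\<^sup>2\<rfloor>} \<and> [d\<^sup>2 * r * t = a] (mod m)}))"
proof -
  define X where "X = nat \<lfloor>x\<rfloor>"
  define P where "P = {(r, s). r \<in> R \<and> s \<in> {1..X} \<and> [r * s = a] (mod m)}"
  define D where "D = {d. d \<in> {1..M} \<and> coprime d m}"
  have sX: "s \<in> {1..X} \<longleftrightarrow> 0 < s \<and> real s \<le> x" for s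
    using x unfolding X_def by (auto simp: le_nat_floor le_nat_iff le_floor_iff)
  have "P \<subseteq> R \<times> {1..X}" by (auto simp: P_def)
  then have finP: "finite P" using fin finite_subset by blast
  have divs: "(\<Sum>d\<in>D. if d\<^sup>2 dvd s then moebius d else 0) = (if squarefree s then 1 else 0)"
    if rs: "(r, s) \<in> P" for r s
  proof -
    have s: "0 < s" "real s \<le> x" "[r * s = a] (mod m)" using rs sX by (auto simp: P_def)
    have "coprime (r * s) m" using a s(3) by (metis cong_imp_coprime cong_sym)
    then have cop: "coprime s m" by simp
    have "{d \<in> D. d\<^sup>2 dvd s} = {d. d\<^sup>2 dvd s}"
    proof (intro set_eqI iffI)
      fix d assume "d \<in> {d. d\<^sup>2 dvd s}"
      then have d: "d\<^sup>2 dvd s" by simp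
      then have "d > 0" using s(1) by (cases d) auto
      have "d\<^sup>2 \<le> s" using d s(1) by (rule dvd_imp_le)
      then have "(real d)\<^sup>2 \<le> real s" by (metis of_nat_le_iff of_nat_power)
      then have "(real d)\<^sup>2 < (real M + 1)\<^sup>2" using s(2) M by linarith
      then have "real d < real M + 1" by (rule power2_less_imp_less) simp
      then have "d \<le> M" by linarith
      moreover have "coprime d m"
        using coprime_divisors[OF d dvd_refl cop] by simp
      ultimately show "d \<in> {d \<in> D. d\<^sup>2 dvd s}" using d \<open>d > 0\<close> by (simp add: D_def)
    qed simp
    moreover have "finite D" by (simp add: D_def)
    ultimately have "(\<Sum>d\<in>D. if d\<^sup>2 dvd s then moebius d else 0) = (\<Sum>d | d\<^sup>2 dvd s. moebius d)"
      by (simp add: sum.If_cases Int_def)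
    then show ?thesis using sum_moebius_square_divisors[OF s(1)] by simp
  qed
  have cnt: "card {(r, s). (r, s) \<in> P \<and> d\<^sup>2 dvd s}
      = card {(r, t). r \<in> R \<and> t \<in> {1..nat \<lfloor>x / (real d)\<^sup>2\<rfloor>} \<and> [d\<^sup>2 * r * t = a] (mod m)}"
    if "d \<in> D" for d
  proof -
    have d: "d > 0" using that by (simp add: D_def)
    have t: "t \<in> {1..nat \<lfloor>x / (real d)\<^sup>2\<rfloor>} \<longleftrightarrow> d\<^sup>2 * t \<in> {1..X}" for t
    proof -
      have "t \<in> {1..nat \<lfloor>x / (real d)\<^sup>2\<rfloor>} \<longleftrightarrow> 0 < t \<and> real t \<le> x / (real d)\<^sup>2"
        using x by (auto simp: le_nat_floor le_nat_iff le_floor_iff)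
      also have "\<dots> \<longleftrightarrow> 0 < t \<and> real (d\<^sup>2 * t) \<le> x" using d by (simp add: field_simps)
      finally show ?thesis using d by (simp only: sX) simp
    qed
    have "bij_betw (\<lambda>(r, t). (r, d\<^sup>2 * t))
        {(r, t). r \<in> R \<and> t \<in> {1..nat \<lfloor>x / (real d)\<^sup>2\<rfloor>} \<and> [d\<^sup>2 * r * t = a] (mod m)}
        {(r, s). (r, s) \<in> P \<and> d\<^sup>2 dvd s}"
      unfolding t P_def using d
      by (intro bij_betwI[where g = "\<lambda>(r, s). (r, s div d\<^sup>2)"]) (auto simp: mult_ac)
    then show ?thesis by (simp add: bij_betw_same_card)
  qed
  have "Q R x m a = card {(r, s). (r, s) \<in> P \<and> squarefree s}"
    unfolding Q_def P_def using sX by (intro arg_cong[where f = card]) auto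
  also have "{(r, s). (r, s) \<in> P \<and> squarefree s} = {p \<in> P. squarefree (snd p)}" by auto
  finally have "real (Q R x m a) = (\<Sum>p\<in>P. if squarefree (snd p) then 1 else 0)"
    using finP by (simp add: sum.If_cases Int_def)
  also have "\<dots> = (\<Sum>p\<in>P. \<Sum>d\<in>D. if d\<^sup>2 dvd snd p then moebius d else 0)"
    using divs by (intro sum.cong) auto
  also have "\<dots> = (\<Sum>d\<in>D. \<Sum>p\<in>P. if d\<^sup>2 dvd snd p then moebius d else 0)" by (rule sum.swap)
  also have "\<dots> = (\<Sum>d\<in>D. moebius d * real (card {(r, s). (r, s) \<in> P \<and> d\<^sup>2 dvd s}))"
  proof (rule sum.cong)
    fix d
    have "{(r, s). (r, s) \<in> P \<and> d\<^sup>2 dvd s} = {p \<in> P. d\<^sup>2 dvd snd p}" by auto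
    then show "(\<Sum>p\<in>P. if d\<^sup>2 dvd snd p then moebius d else 0)
        = moebius d * real (card {(r, s). (r, s) \<in> P \<and> d\<^sup>2 dvd s})"
      using finP by (simp add: sum.If_cases Int_def)
  qed simp
  also have "\<dots> = (\<Sum>d\<in>D. moebius d *
      real (card {(r, t). r \<in> R \<and> t \<in> {1..nat \<lfloor>x / (real d)\<^sup>2\<rfloor>} \<and> [d\<^sup>2 * r * t = a] (mod m)}))"
    using cnt by (intro sum.cong) auto
  finally show ?thesis by (simp add: D_def)
qed

text \<open>
  For \<open>d \<le> D\<close> the assumed bound \<open>\<Delta>\<close> is used and for \<open>d > D\<close> the trivial one. The constant 6 consists of 4 from
  the trivial bound summed over \<open>d > D\<close> and 2 from truncating the series for \<open>vartheta m\<close>.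
\<close>
lemma squarefree_discrepancy_le:
  fixes R :: "nat set" and m D :: nat and x \<Delta> :: real
  assumes m: "m > 0" and x: "x > 0" and fin: "finite R"
    and \<Delta>: "\<And>d. d > 0 \<Longrightarrow> coprime d m \<Longrightarrow>
      (\<Sum>a\<in>{1..m}. \<bar>real (card {(r, t). r \<in> R \<and> t \<in> {1..nat \<lfloor>x / (real d)\<^sup>2\<rfloor>} \<and> [d\<^sup>2 * r * t = a] (mod m)})
        - real (card R) * (x / (real d)\<^sup>2) / real m\<bar>) \<le> \<Delta>"
  shows "(\<Sum>a | a \<in> {1..m} \<and> coprime a m. \<bar>real (Q R x m a) - vartheta m * (real (card R) * x / real m)\<bar>)
    \<le> real D * \<Delta> + 6 * (real (card R) * x) / (real D + 1)"
proof -
  define q where "q = real (card R) * x"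
  \<comment> \<open>Any \<open>M\<close> with \<open>M \<ge> D\<close> and \<open>x < (M + 1)\<^sup>2\<close> would do.\<close>
  define M where "M = D + nat \<lceil>x\<rceil>"
  define A where "A = {a. a \<in> {1..m} \<and> coprime a m}"
  define H where "H = {d. d \<in> {1..M} \<and> coprime d m}"
  define N where "N = (\<lambda>d a. real (card {(r, t). r \<in> R \<and> t \<in> {1..nat \<lfloor>x / (real d)\<^sup>2\<rfloor>} \<and> [d\<^sup>2 * r * t = a] (mod m)}))"
  define E where "E = (\<lambda>d. \<Sum>a\<in>{1..m}. \<bar>N d a - real (card R) * (x / (real d)\<^sup>2) / real m\<bar>)"
  have q0: "q \<ge> 0" using x by (simp add: q_def)
  have finH: "finite H" by (simp add: H_def)
  have xM: "x < (real M + 1)\<^sup>2"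
  proof -
    have "x < real M + 1" unfolding M_def by linarith
    also have "\<dots> \<le> (real M + 1)\<^sup>2" by (simp add: power2_eq_square)
    finally show ?thesis .
  qed
  have tail: "\<bar>vartheta m - (\<Sum>d\<in>H. moebius d / (real d)\<^sup>2)\<bar> \<le> 2 / (real D + 1)"
  proof -
    have "\<bar>vartheta m - (\<Sum>d\<in>H. moebius d / (real d)\<^sup>2)\<bar> \<le> 2 / (real M + 1)"
      unfolding H_def using m by (rule vartheta_partial_sum_error)
    also have "\<dots> \<le> 2 / (real D + 1)" by (intro divide_left_mono) (auto simp: M_def)
    finally show ?thesis .
  qed
  have pt: "\<bar>real (Q R x m a) - vartheta m * (q / real m)\<bar>
      \<le> (\<Sum>d\<in>H. \<bar>N d a - real (card R) * (x / (real d)\<^sup>2) / real m\<bar>) + 2 / (real D + 1) * (q / real m)"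
    if "a \<in> A" for a
  proof -
    have Q: "real (Q R x m a) = (\<Sum>d\<in>H. moebius d * N d a)"
      using Q_eq_moebius_sum[OF fin _ xM, of a m] x that by (simp add: A_def H_def N_def)
    have "real (Q R x m a) - vartheta m * (q / real m)
        = (\<Sum>d\<in>H. moebius d * (N d a - real (card R) * (x / (real d)\<^sup>2) / real m))
          - (vartheta m - (\<Sum>d\<in>H. moebius d / (real d)\<^sup>2)) * (q / real m)"
      unfolding Q by (simp add: right_diff_distrib left_diff_distrib sum_subtractf
          sum_distrib_left sum_distrib_right sum_divide_distrib q_def mult_ac)
    also have "\<bar>\<dots>\<bar> \<le> \<bar>\<Sum>d\<in>H. moebius d * (N d a - real (card R) * (x / (real d)\<^sup>2) / real m)\<bar>
          + \<bar>vartheta m - (\<Sum>d\<in>H. moebius d / (real d)\<^sup>2)\<bar> * (q / real m)"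
      using q0 by (intro order_trans[OF abs_triangle_ineq4]) (simp add: abs_mult)
    also have "\<dots> \<le> (\<Sum>d\<in>H. \<bar>N d a - real (card R) * (x / (real d)\<^sup>2) / real m\<bar>)
          + 2 / (real D + 1) * (q / real m)"
    proof (intro add_mono mult_right_mono tail)
      show "\<bar>\<Sum>d\<in>H. moebius d * (N d a - real (card R) * (x / (real d)\<^sup>2) / real m)\<bar>
          \<le> (\<Sum>d\<in>H. \<bar>N d a - real (card R) * (x / (real d)\<^sup>2) / real m\<bar>)"
        by (intro order_trans[OF sum_abs] sum_mono)
           (simp add: abs_mult mult_left_le_one_le abs_moebius_le_1)
    qed (use q0 in simp)
    finally show ?thesis .
  qed
  have E: "E d \<le> (if d \<le> D then \<Delta> else 2 * q * (1 / (real d)\<^sup>2))" if "d \<in> H" for d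
  proof -
    have "E d \<le> \<Delta>" using \<Delta>[of d] that by (simp add: E_def N_def H_def)
    moreover have "E d \<le> 2 * q * (1 / (real d)\<^sup>2)"
      using residue_discrepancy_trivial[OF m fin, of "x / (real d)\<^sup>2" "d\<^sup>2"] x
      by (simp add: E_def N_def q_def)
    ultimately show ?thesis by simp
  qed
  have \<Delta>0: "\<Delta> \<ge> 0"
    by (rule order_trans[OF _ \<Delta>[of 1]]) (auto intro: sum_nonneg)
  have AE: "(\<Sum>a\<in>A. \<Sum>d\<in>H. \<bar>N d a - real (card R) * (x / (real d)\<^sup>2) / real m\<bar>) \<le> (\<Sum>d\<in>H. E d)"
    unfolding E_def by (subst sum.swap) (auto simp: A_def intro!: sum_mono sum_mono2)
  have sumE: "(\<Sum>d\<in>H. E d) \<le> real D * \<Delta> + 2 * q * (2 / (real D + 1))"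
  proof -
    have "(\<Sum>d\<in>H. E d) \<le> (\<Sum>d\<in>H. if d \<le> D then \<Delta> else 2 * q * (1 / (real d)\<^sup>2))"
      using E by (rule sum_mono)
    also have "\<dots> \<le> (\<Sum>d\<in>{1..M}. if d \<le> D then \<Delta> else 2 * q * (1 / (real d)\<^sup>2))"
      using \<Delta>0 q0 by (intro sum_mono2) (auto simp: H_def)
    also have "\<dots> = (\<Sum>d\<in>{1..D}. \<Delta>) + (\<Sum>d\<in>{D<..M}. 2 * q * (1 / (real d)\<^sup>2))"
    proof -
      have "{1..M} = {1..D} \<union> {D<..M}" by (auto simp: M_def)
      then show ?thesis by (simp only:) (subst sum.union_disjoint, auto intro!: arg_cong2[where f = "(+)"] sum.cong)
    qed
    also have "\<dots> = real D * \<Delta> + 2 * q * (\<Sum>d\<in>{D<..M}. 1 / (real d)\<^sup>2)"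
      by (simp add: sum_distrib_left)
    also have "\<dots> \<le> real D * \<Delta> + 2 * q * (2 / (real D + 1))"
      using q0 by (intro add_left_mono mult_left_mono sum_inverse_squares_tail_le) auto
    finally show ?thesis .
  qed
  have cA: "real (card A) * (2 / (real D + 1) * (q / real m)) \<le> 2 * q / (real D + 1)"
  proof -
    have "card A \<le> card {1..m}" by (intro card_mono) (auto simp: A_def)
    then have "real (card A) \<le> real m" by simp
    then have "real (card A) * (2 / (real D + 1) * (q / real m)) \<le> real m * (2 / (real D + 1) * (q / real m))"
      using q0 by (intro mult_right_mono) auto
    also have "\<dots> = 2 * q / (real D + 1)" using m by simp
    finally show ?thesis .
  qed
  have "(\<Sum>a\<in>A. \<bar>real (Q R x m a) - vartheta m * (q / real m)\<bar>)
      \<le> (\<Sum>a\<in>A. (\<Sum>d\<in>H. \<bar>N d a - real (card R) * (x / (real d)\<^sup>2) / real m\<bar>) + 2 / (real D + 1) * (q / real m))"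
    using pt by (rule sum_mono)
  also have "\<dots> = (\<Sum>a\<in>A. \<Sum>d\<in>H. \<bar>N d a - real (card R) * (x / (real d)\<^sup>2) / real m\<bar>)
      + real (card A) * (2 / (real D + 1) * (q / real m))" by (simp add: sum.distrib)
  also have "\<dots> \<le> (real D * \<Delta> + 2 * q * (2 / (real D + 1))) + 2 * q / (real D + 1)"
    using AE sumE cA by (intro add_mono) auto
  also have "\<dots> = real D * \<Delta> + 6 * q / (real D + 1)"
    by (simp only: times_divide_eq_right add.assoc add_divide_distrib[symmetric]) simp
  finally show ?thesis by (simp add: A_def q_def)
qed

lemma card_divisors_two_power: "card {d::nat. d dvd 2 ^ L} = L + 1"
proof -
  have "{d::nat. d dvd 2 ^ L} = (\<lambda>i. 2 ^ i) ` {..L}"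
    by (auto simp: divides_primepow_nat)
  then show ?thesis by (simp add: card_image inj_on_def)
qed

lemma ex_two_power_between:
  assumes "m > 0"
  shows "\<exists>L. m \<le> 2 ^ L \<and> 2 ^ L \<le> 2 * (m::nat)"
proof -
  define L where "L = (LEAST L. m \<le> 2 ^ L)"
  have 1: "m \<le> 2 ^ L" unfolding L_def by (rule LeastI[of _ m]) (simp add: less_imp_le)
  have "2 ^ L \<le> 2 * m"
  proof (cases L)
    case 0
    then show ?thesis using assms by simp
  next
    case (Suc k)
    then have "\<not> m \<le> 2 ^ k" using not_less_Least[of k "\<lambda>L. m \<le> 2 ^ L"] by (simp add: L_def)
    then show ?thesis using Suc by simp
  qed
  with 1 show ?thesis by blast
qed

theorem theorem3:
  fixes \<epsilon> :: real
  assumes "\<epsilon> > 0"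
  shows "\<exists>C :: real. \<forall>(m :: nat) (x :: real) (R :: nat set).
    m > 0 \<longrightarrow> x > 0 \<longrightarrow> (\<forall>r\<in>R. 1 \<le> r \<and> real r \<le> x \<and> coprime r m) \<longrightarrow>
    (\<Sum>a | a \<in> {1..m} \<and> coprime a m.
        \<bar>real (Q R x m a) - vartheta m * (real (card R) * x / real m)\<bar>)
      \<le> C * real (card R) powr (3/4) * x powr (3/4) * real m powr (1/4 + \<epsilon>)"
proof -
  \<comment> \<open>One factor \<open>m powr \<delta>\<close> is lost in \<open>L + 1\<close> and two in \<open>T\<close>, which concerns divisors of numbers up to \<open>2 m\<^sup>2\<close>.\<close>
  define \<delta> where "\<delta> = \<epsilon> / 3"
  have \<delta>: "\<delta> > 0" using assms by (simp add: \<delta>_def)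
  obtain C where C: "C \<ge> 1" "\<And>n::nat. n > 0 \<Longrightarrow> real (card {d. d dvd n}) \<le> C * real n powr \<delta>"
    using card_divisors_le_powr[OF \<delta>] by blast
  define C' where "C' = 5 * (C\<^sup>2 * 4 powr \<delta>) + 6"
  show ?thesis
  proof (intro exI[of _ C'] allI impI)
    fix m :: nat and x :: real and R :: "nat set"
    assume m: "m > 0" and x: "x > 0" and R: "\<forall>r\<in>R. 1 \<le> r \<and> real r \<le> x \<and> coprime r m"
    have "R \<subseteq> {..nat \<lfloor>x\<rfloor>}" using R by (auto simp: le_nat_floor)
    then have fin: "finite R" using finite_subset by blast
    define q where "q = real (card R) * x"
    define K where "K = C\<^sup>2 * 4 powr \<delta> * real m powr \<epsilon>"
    obtain L where L: "m \<le> 2 ^ L" "2 ^ L \<le> 2 * m" using ex_two_power_between[OF m] by blast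
    define T where "T = nat \<lfloor>C * real (2 * m * m) powr \<delta>\<rfloor>"
    have T: "card {d. d dvd k} \<le> T" if "0 < k" "k \<le> 2 ^ L * m" for k
    proof -
      have "k \<le> 2 * m * m" using that L(2) mult_le_mono1 le_trans by blast
      then have "real k powr \<delta> \<le> real (2 * m * m) powr \<delta>" using \<delta> by (intro powr_mono2) (auto simp flip: of_nat_mult)
      then have "C * real k powr \<delta> \<le> C * real (2 * m * m) powr \<delta>" using C(1) by simp
      then show ?thesis using C(2)[OF that(1)] unfolding T_def by (intro le_nat_floor) linarith
    qed
    have LT: "(real L + 1) * real T \<le> K"
    proof -
      \<comment> \<open>The number of levels is itself a divisor count, so the divisor bound covers the logarithm as well.\<close>
      have "real L + 1 = real (card {d::nat. d dvd 2 ^ L})" by (simp add: card_divisors_two_power)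
      also have "\<dots> \<le> C * real (2 ^ L) powr \<delta>" by (rule C(2)) simp
      also have "\<dots> \<le> C * real (2 * m) powr \<delta>"
        using L(2) C(1) \<delta> of_nat_mono[OF L(2), where ?'a = real] by (intro mult_left_mono powr_mono2) auto
      finally have 1: "real L + 1 \<le> C * real (2 * m) powr \<delta>" .
      have 2: "real T \<le> C * real (2 * m * m) powr \<delta>" using C(1) unfolding T_def by simp
      have "(real L + 1) * real T \<le> (C * real (2 * m) powr \<delta>) * (C * real (2 * m * m) powr \<delta>)"
        using 1 2 C(1) by (intro mult_mono) auto
      also have "\<dots> = C\<^sup>2 * (real (2 * m) * real (2 * m * m)) powr \<delta>"
        by (subst powr_mult) (simp_all only: of_nat_0_le_iff power2_eq_square mult_ac)
      also have "real (2 * m) * real (2 * m * m) = 4 * real m ^ 3"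
        by (simp add: power3_eq_cube)
      also have "(4 * real m ^ 3) powr \<delta> = 4 powr \<delta> * (real m powr 3) powr \<delta>"
        using m by (simp add: powr_mult)
      also have "(real m powr 3) powr \<delta> = real m powr \<epsilon>"
        by (simp only: powr_powr) (simp add: \<delta>_def)
      finally show ?thesis by (simp add: K_def mult_ac)
    qed
    \<comment> \<open>This \<open>D\<close> balances \<open>D * sqrt (m q)\<close> against \<open>q / D\<close>.\<close>
    define D where "D = nat \<lfloor>(q / real m) powr (1/4)\<rfloor>"
    have D: "real D \<le> (q / real m) powr (1/4)" "(q / real m) powr (1/4) \<le> real D + 1"
      unfolding D_def by simp linarith
    define G where "G = q powr (3/4) * real m powr (1/4)"
    show "(\<Sum>a | a \<in> {1..m} \<and> coprime a m.
        \<bar>real (Q R x m a) - vartheta m * (real (card R) * x / real m)\<bar>)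
      \<le> C' * real (card R) powr (3/4) * x powr (3/4) * real m powr (1/4 + \<epsilon>)"
    proof (cases "card R = 0")
      case True
      then have "R = {}" using fin by simp
      then show ?thesis by (simp add: Q_def)
    next
      case False
      then have q: "q > 0" using x by (simp add: q_def)
      have "(\<Sum>a | a \<in> {1..m} \<and> coprime a m.
          \<bar>real (Q R x m a) - vartheta m * (real (card R) * x / real m)\<bar>)
          \<le> real D * (5 * (real L + 1) * real T * sqrt (real m * q)) + 6 * q / (real D + 1)"
        unfolding q_def
      proof (rule squarefree_discrepancy_le[OF m x fin])
        fix d :: nat assume d: "d > 0" "coprime d m"
        have "1 \<le> (real d)\<^sup>2" using d(1) by simp
        then have "x / (real d)\<^sup>2 \<le> x"
          using x d(1) divide_left_mono[of 1 "(real d)\<^sup>2" x] by simp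
        then show "(\<Sum>a\<in>{1..m}. \<bar>real (card {(r, t). r \<in> R \<and> t \<in> {1..nat \<lfloor>x / (real d)\<^sup>2\<rfloor>} \<and> [d\<^sup>2 * r * t = a] (mod m)})
            - real (card R) * (x / (real d)\<^sup>2) / real m\<bar>)
            \<le> 5 * (real L + 1) * real T * sqrt (real m * (real (card R) * x))"
          using d R x T by (intro residue_discrepancy_le m fin L) auto
      qed
      also have "\<dots> \<le> 5 * K * G + 6 * G"
      proof (rule add_mono)
        have s: "sqrt (real m * q) = (real m * q) powr (1/2)"
          using q m by (simp add: powr_half_sqrt)
        have "real D * sqrt (real m * q) \<le> (q / real m) powr (1/4) * sqrt (real m * q)"
          using D(1) q by (intro mult_right_mono) auto
        also have "\<dots> = (q powr (1/4) * q powr (1/2)) * (real m powr (1/2) / real m powr (1/4))"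
          using q m unfolding s by (simp add: powr_divide powr_mult)
        also have "\<dots> = G" using q m unfolding G_def by (simp flip: powr_add powr_diff)
        finally have le: "((real L + 1) * real T) * (real D * sqrt (real m * q)) \<le> K * G"
          using LT q by (intro mult_mono) (auto simp: K_def)
        have "real D * (5 * (real L + 1) * real T * sqrt (real m * q))
            = 5 * (((real L + 1) * real T) * (real D * sqrt (real m * q)))" by (simp only: mult_ac)
        also have "\<dots> \<le> 5 * (K * G)" using le by (rule mult_left_mono) simp
        finally show "real D * (5 * (real L + 1) * real T * sqrt (real m * q)) \<le> 5 * K * G"
          by (simp only: mult.assoc)
        have "q / (real D + 1) \<le> q / (q / real m) powr (1/4)"
          using D(2) q m by (intro divide_left_mono mult_pos_pos) auto
        also have "\<dots> = (q powr 1 / q powr (1/4)) * real m powr (1/4)"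
          using q m by (simp add: powr_divide)
        also have "\<dots> = G" using q unfolding G_def by (simp only: flip: powr_diff) simp
        finally show "6 * q / (real D + 1) \<le> 6 * G" by simp
      qed
      also have "\<dots> \<le> C' * real m powr \<epsilon> * G"
      proof -
        have "1 \<le> real m powr \<epsilon>" using m assms by (intro ge_one_powr_ge_zero) auto
        then have "5 * K + 6 \<le> C' * real m powr \<epsilon>" by (simp add: C'_def K_def algebra_simps)
        then have "(5 * K + 6) * G \<le> C' * real m powr \<epsilon> * G"
          by (intro mult_right_mono) (auto simp: G_def)
        then show ?thesis by (simp add: distrib_right)
      qed
      also have "\<dots> = C' * real (card R) powr (3/4) * x powr (3/4) * real m powr (1/4 + \<epsilon>)"
        using x by (simp add: G_def q_def powr_mult powr_add mult_ac)
      finally show ?thesis .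
    qed
  qed
qed

end
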